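(* Let $(X,\sigma)$ be a transitive shift for which $$0<\limsup_{n\to\infty}\frac{P_X(n)}{n}<\infty.$$ Then the quotient group $\mathrm{Aut}(X)/\langle\sigma\rangle$ is finite. In particular, $\mathrm{Aut}(X)$ is virtually $\mathbb{Z}$.
   Context: Let $\mathcal{A}$ be a finite alphabet with the discrete topology, give $\mathcal{A}^{\mathbb{Z}}$ the product topology, and let $\sigma\colon\mathcal{A}^{\mathbb{Z}}\to\mathcal{A}^{\mathbb{Z}}$ be the left shift $(\sigma x)(n)=x(n+1)$. A shift $(X,\sigma)$ is a closed set $X\subseteq\mathcal{A}^{\mathbb{Z}}$ with $\sigma(X)=X$. The orbit of $x\in X$ is $\mathcal{O}(x)=\{\sigma^n x: n\in\mathbb{Z}\}$. The shift is transitive if some $x\in X$ has orbit dense in $X$. $\mathrm{Aut}(X)$ is the group of homeomorphisms of $X$ to itself that commute with $\sigma$, and $\langle\sigma\rangle$ is its (central) subgroup generated by $\sigma$. The complexity function $P_X(n)$ is the number of words $w=(a_0,\dots,a_{n-1})\in\mathcal{A}^n$ for which there is $x\in X$ with $x(i)=a_i$ for all $0\le i<n$. A group $G$ is virtually $H$ if it contains a subgroup of finite index isomorphic to $H$. *)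

theory Defs
  imports
    "HOL-Analysis.Analysis"
    "HOL-Algebra.Bij"
    "HOL-Algebra.Elementary_Groups"
begin

text \<open>
  The alphabet is an arbitrary finite type, and its bi-infinite sequences are the functions
  from \<^typ>\<open>int\<close> to it.
\<close>

definition seq_topology :: "(int \<Rightarrow> 'a) topology" where
  "seq_topology = product_topology (\<lambda>_. discrete_topology UNIV) UNIV"

definition left_shift :: "(int \<Rightarrow> 'a) \<Rightarrow> (int \<Rightarrow> 'a)" where
  "left_shift x = (\<lambda>i. x (i + 1))"

definition is_shift :: "(int \<Rightarrow> 'a) set \<Rightarrow> bool" where
  "is_shift X \<longleftrightarrow> closedin seq_topology X \<and> left_shift ` X = X"

text \<open>
  The integer iterate of the shift is given in closed form; the lemmas below show that it
  is the group action of the integers generated by \<^const>\<open>left_shift\<close>.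
\<close>

definition shift_power :: "int \<Rightarrow> (int \<Rightarrow> 'a) \<Rightarrow> (int \<Rightarrow> 'a)" where
  "shift_power n x = (\<lambda>i. x (i + n))"

lemma shift_power_0: "shift_power 0 = id"
  by (auto simp: shift_power_def)

lemma shift_power_1: "shift_power 1 = left_shift"
  by (auto simp: shift_power_def left_shift_def)

lemma shift_power_add: "shift_power (m + n) = shift_power m \<circ> shift_power n"
  by (auto simp: shift_power_def fun_eq_iff ac_simps)

definition shift_orbit :: "(int \<Rightarrow> 'a) \<Rightarrow> (int \<Rightarrow> 'a) set" where
  "shift_orbit x = {shift_power n x | n. True}"

definition transitive_shift :: "(int \<Rightarrow> 'a) set \<Rightarrow> bool" where
  "transitive_shift X \<longleftrightarrow>
     is_shift X \<and> (\<exists>x\<in>X. subtopology seq_topology X closure_of shift_orbit x = X)"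

definition complexity :: "(int \<Rightarrow> 'a) set \<Rightarrow> nat \<Rightarrow> nat" where
  "complexity X n = card {w. length w = n \<and> (\<exists>x\<in>X. \<forall>i<n. x (int i) = w ! i)}"

text \<open>
  As in \<^const>\<open>BijGroup\<close>, a self-map of \<open>X\<close> is represented by the extensional function with
  the same values on \<open>X\<close>, so that each automorphism has exactly one representative.
\<close>

definition shift_automorphisms :: "(int \<Rightarrow> 'a) set \<Rightarrow> ((int \<Rightarrow> 'a) \<Rightarrow> (int \<Rightarrow> 'a)) set" where
  "shift_automorphisms X =
     {f \<in> extensional X.
        homeomorphic_map (subtopology seq_topology X) (subtopology seq_topology X) f \<and>
        (\<forall>x\<in>X. f (left_shift x) = left_shift (f x))}"

definition Aut_shift :: "(int \<Rightarrow> 'a) set \<Rightarrow> ((int \<Rightarrow> 'a) \<Rightarrow> (int \<Rightarrow> 'a)) monoid" where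
  "Aut_shift X = BijGroup X \<lparr>carrier := shift_automorphisms X\<rparr>"

definition shift_subgroup :: "(int \<Rightarrow> 'a) set \<Rightarrow> ((int \<Rightarrow> 'a) \<Rightarrow> (int \<Rightarrow> 'a)) set" where
  "shift_subgroup X = generate (Aut_shift X) {restrict left_shift X}"

definition virtually :: "('a, 'c) monoid_scheme \<Rightarrow> ('b, 'd) monoid_scheme \<Rightarrow> bool" where
  "virtually G H \<longleftrightarrow> (\<exists>K. subgroup K G \<and> finite (rcosets\<^bsub>G\<^esub> K) \<and> G\<lparr>carrier := K\<rparr> \<cong> H)"

lemma topspace_seq_topology [simp]: "topspace seq_topology = UNIV"
  by (auto simp: seq_topology_def)

lemma shift_automorphisms_subset_Bij: "shift_automorphisms X \<subseteq> Bij X"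
  by (auto simp: shift_automorphisms_def Bij_def bij_betw_def
      homeomorphic_eq_everything_map)

lemma subgroup_shift_automorphisms:
  assumes "is_shift X"
  shows "subgroup (shift_automorphisms X) (BijGroup X)"
proof (rule subgroup.intro)
  let ?T = "subtopology seq_topology X"
  have sX: "left_shift x \<in> X" if "x \<in> X" for x
    using assms that by (auto simp: is_shift_def)
  note B = subsetD[OF shift_automorphisms_subset_Bij]
  show "shift_automorphisms X \<subseteq> carrier (BijGroup X)"
    using B by (auto simp: BijGroup_def)
  show "\<one>\<^bsub>BijGroup X\<^esub> \<in> shift_automorphisms X"
  proof -
    have "homeomorphic_map ?T ?T (\<lambda>x\<in>X. x)"
      by (rule homeomorphic_map_eq[of _ _ id]) auto
    then show ?thesis
      using sX by (auto simp: BijGroup_def shift_automorphisms_def)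
  qed
  fix f assume f: "f \<in> shift_automorphisms X"
  have fX: "f x \<in> X" if "x \<in> X" for x
    using B[OF f] that by (auto simp: Bij_def bij_betw_def)
  {
    fix g assume g: "g \<in> shift_automorphisms X"
    have gX: "g x \<in> X" if "x \<in> X" for x
      using B[OF g] that by (auto simp: Bij_def bij_betw_def)
    have "homeomorphic_map ?T ?T (f \<circ> g)"
      using f g by (auto simp: shift_automorphisms_def intro: homeomorphic_map_compose)
    then have "homeomorphic_map ?T ?T (compose X f g)"
      by (rule homeomorphic_map_eq) (auto simp: compose_def)
    then show "f \<otimes>\<^bsub>BijGroup X\<^esub> g \<in> shift_automorphisms X"
      using f g B[OF f] B[OF g] gX sX
      by (auto simp: BijGroup_def shift_automorphisms_def compose_def)
  }
  have bij: "bij_betw f X X"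
    using B[OF f] by (simp add: Bij_def)
  obtain g where g: "homeomorphic_maps ?T ?T f g"
    using f by (auto simp: shift_automorphisms_def homeomorphic_map_maps)
  have gf: "g (f x) = x" "f (g x) = x" "g x \<in> X" if "x \<in> X" for x
    using g that by (auto simp: homeomorphic_maps_def continuous_map_def)
  have inv: "inv_into X f x = g x" if "x \<in> X" for x
    using gf[OF that] bij by (metis bij_betw_def inv_into_f_f)
  have "homeomorphic_map ?T ?T (restrict (inv_into X f) X)"
    using g inv by (auto simp: homeomorphic_maps_map intro!: homeomorphic_map_eq[of _ _ g])
  moreover have "g (left_shift x) = left_shift (g x)" if "x \<in> X" for x
  proof -
    have "f (left_shift (g x)) = left_shift x"
      using f gf that by (auto simp: shift_automorphisms_def)
    then show ?thesis
      using gf sX that by metis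
  qed
  ultimately show "inv\<^bsub>BijGroup X\<^esub> f \<in> shift_automorphisms X"
    using inv_BijGroup[OF B[OF f]] inv gf sX
    by (auto simp: shift_automorphisms_def)
qed

lemma group_Aut_shift:
  assumes "is_shift X"
  shows "group (Aut_shift X)"
  unfolding Aut_shift_def
  using subgroup.subgroup_is_group[OF subgroup_shift_automorphisms[OF assms] group_BijGroup] .

lemma left_shift_in_Aut_shift:
  assumes "is_shift X"
  shows "restrict left_shift X \<in> carrier (Aut_shift X)"
proof -
  let ?T = "subtopology seq_topology X"
  have cont: "continuous_map seq_topology seq_topology (shift_power n)" for n :: int
    unfolding seq_topology_def shift_power_def
    by (subst continuous_map_componentwise_UNIV) (auto intro: continuous_map_product_projection)
  have XX: "left_shift ` X = X"
    using assms by (simp add: is_shift_def)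
  have inverse: "shift_power (- 1) (left_shift x) = x" "left_shift (shift_power (- 1) x) = x"
    for x :: "int \<Rightarrow> 'a"
    by (auto simp: shift_power_def left_shift_def)
  have "shift_power (- 1) ` X = X"
    by (subst XX[symmetric]) (auto simp: image_image inverse)
  then have "homeomorphic_maps ?T ?T left_shift (shift_power (- 1))"
    using cont[of 1] cont[of "- 1"] XX
    by (auto simp: homeomorphic_maps_def continuous_map_in_subtopology shift_power_1 inverse
        intro: continuous_map_from_subtopology)
  then have "homeomorphic_map ?T ?T left_shift"
    by (auto simp: homeomorphic_map_maps)
  then have "homeomorphic_map ?T ?T (restrict left_shift X)"
    by (rule homeomorphic_map_eq) auto
  then show ?thesis
    using XX by (auto simp: Aut_shift_def shift_automorphisms_def)
qed

lemma shift_subgroup_normal: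
  assumes "is_shift X"
  shows "shift_subgroup X \<lhd> Aut_shift X"
proof -
  interpret group "Aut_shift X" by (rule group_Aut_shift[OF assms])
  let ?s = "restrict left_shift X"
  have s: "?s \<in> carrier (Aut_shift X)" by (rule left_shift_in_Aut_shift[OF assms])
  have B: "f \<in> Bij X" if "f \<in> carrier (Aut_shift X)" for f
    using that shift_automorphisms_subset_Bij by (auto simp: Aut_shift_def)
  have comm: "f \<otimes>\<^bsub>Aut_shift X\<^esub> ?s = ?s \<otimes>\<^bsub>Aut_shift X\<^esub> f"
    if "f \<in> carrier (Aut_shift X)" for f
    using that B[OF that] B[OF s]
    by (auto simp: Aut_shift_def BijGroup_def compose_def shift_automorphisms_def Bij_def
        bij_betw_def fun_eq_iff restrict_def)
  have "f \<otimes>\<^bsub>Aut_shift X\<^esub> ?s \<otimes>\<^bsub>Aut_shift X\<^esub> inv\<^bsub>Aut_shift X\<^esub> f = ?s"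
    if "f \<in> carrier (Aut_shift X)" for f
    using comm[OF that] s that by (simp add: m_assoc)
  then show ?thesis
    unfolding shift_subgroup_def using s
    by (intro normal_generateI) (auto intro: generate.incl)
qed

end

theory Submission
  imports Defs
begin

text \<open>
  An automorphism is determined modulo powers of the shift by the orbit to which it sends a
  single point with dense orbit. So it suffices to find a set of points that is preserved by all
  automorphisms, contains a point with dense orbit and meets only finitely many orbits.

  If some orbit is not dense, take the points that are not recurrent in one of the two
  directions. Windows of length \<open>N\<close> around representatives of \<open>M\<close> such orbits are distinct words up
  to boundary effects, so there are about \<open>M * N\<close> words of length \<open>N\<close> and linear complexity bounds
  \<open>M\<close>. A dense orbit contains long stretches that look like a non-dense one; a limit at
  the last occurrence before such stretches of a fixed word of the dense orbit is not recurrent.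

  If all orbits are dense, take the points that are left asymptotic to another point.
  Since the increments of the complexity are bounded infinitely often, only
  finitely many pasts can be continued in two ways, and every left asymptotic point is, up to the
  shift, determined by its past and its symbol at its last branching time.
\<close>

section \<open>Central windows as a neighbourhood base, and compactness\<close>

definition agree :: "nat \<Rightarrow> (int \<Rightarrow> 'a) \<Rightarrow> (int \<Rightarrow> 'a) \<Rightarrow> bool" where
  "agree n x y \<longleftrightarrow> (\<forall>i. \<bar>i\<bar> \<le> int n \<longrightarrow> x i = y i)"

lemma agree_refl [simp]: "agree n x x"
  by (simp add: agree_def)

lemma agree_sym: "agree n x y \<Longrightarrow> agree n y x"
  by (simp add: agree_def)

lemma agree_trans: "agree n x y \<Longrightarrow> agree n y z \<Longrightarrow> agree n x z"
  by (simp add: agree_def)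

lemma agree_mono: "agree n x y \<Longrightarrow> m \<le> n \<Longrightarrow> agree m x y"
  by (simp add: agree_def)

lemma agree_all_imp_eq: "(\<And>n. agree n x y) \<Longrightarrow> x = y"
proof
  fix i assume "\<And>n. agree n x y"
  then have "agree (nat \<bar>i\<bar>) x y" .
  then show "x i = y i" by (simp add: agree_def)
qed

lemma agree_shift:
  assumes "agree n x y" "int m + \<bar>k\<bar> \<le> int n"
  shows "agree m (shift_power k x) (shift_power k y)"
  using assms unfolding agree_def shift_power_def by auto

lemma shift_power_shift_power [simp]: "shift_power k (shift_power l x) = shift_power (k + l) x"
  by (simp add: shift_power_add)

lemma shift_power_zero [simp]: "shift_power 0 x = x"
  by (simp add: shift_power_0)

lemma openin_agree: "openin seq_topology {y. agree n x (y :: int \<Rightarrow> 'a)}"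
proof -
  have *: "openin seq_topology {y :: int \<Rightarrow> 'a. y i = x i}" for i
  proof -
    have "continuous_map seq_topology (discrete_topology UNIV) (\<lambda>y :: int \<Rightarrow> 'a. y i)"
      unfolding seq_topology_def by (rule continuous_map_product_projection) simp
    then have "openin seq_topology {y \<in> topspace seq_topology. y i \<in> {x i}}"
      by (rule openin_continuous_map_preimage) simp
    then show ?thesis by simp
  qed
  have "{y. agree n x y} = (\<Inter>i\<in>{- int n..int n}. {y. y i = x i})"
    by (fastforce simp: agree_def abs_le_iff)
  moreover have "openin seq_topology (\<Inter>i\<in>{- int n..int n}. {y :: int \<Rightarrow> 'a. y i = x i})"
    by (rule openin_INT2) (auto intro: *)
  ultimately show ?thesis by simp
qed

text \<open>A basic open set of the product restricts only finitely many coordinates, so a window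
  covering all of them suffices. With \<open>openin_agree\<close> this makes the windows a
  neighbourhood base.\<close>

lemma openin_seq_topology_agree:
  assumes "openin seq_topology U" "x \<in> U"
  obtains n where "\<And>y. agree n x y \<Longrightarrow> y \<in> U"
proof -
  obtain V where V: "finite {i. V i \<noteq> UNIV}" "x \<in> Pi\<^sub>E UNIV V" "Pi\<^sub>E UNIV V \<subseteq> U"
    using assms unfolding seq_topology_def openin_product_topology_alt by auto
  \<comment> \<open>The sum of the finitely many absolute values dominates each of them and serves
    as \<open>n\<close>.\<close>
  obtain n where n: "\<And>i. i \<in> {i. V i \<noteq> UNIV} \<Longrightarrow> nat \<bar>i\<bar> \<le> n"
  proof
    fix i assume "i \<in> {i. V i \<noteq> UNIV}"
    then show "nat \<bar>i\<bar> \<le> (\<Sum>i\<in>{i. V i \<noteq> UNIV}. nat \<bar>i\<bar>)"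
      using V(1) by (intro member_le_sum) auto
  qed
  show thesis
  proof
    fix y assume y: "agree n x y"
    have "y i \<in> V i" for i
    proof (cases "V i = UNIV")
      case False
      then have "\<bar>i\<bar> \<le> int n" using n[of i] by auto
      then have "y i = x i" using y by (simp add: agree_def)
      then show ?thesis using V(2) by auto
    qed simp
    then show "y \<in> U" using V(3) by auto
  qed
qed

lemma closedin_agree_limit:
  assumes "closedin seq_topology X" and lim: "\<And>n. \<exists>y\<in>X. agree n x y"
  shows "x \<in> X"
proof (rule ccontr)
  assume "x \<notin> X"
  moreover have "openin seq_topology (UNIV - X)"
    using assms(1) by (metis openin_diff openin_topspace topspace_seq_topology)
  ultimately obtain n where "\<And>y. agree n x y \<Longrightarrow> y \<in> UNIV - X"
    by (metis openin_seq_topology_agree DiffI UNIV_I)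
  then show False using lim[of n] by auto
qed

text \<open>The closures of the tails of \<open>u\<close> are nested and nonempty, so by compactness
  they share a point. One number \<open>n\<close> bounds the index from below and the window at
  once, which spares passing to a subsequence.\<close>

lemma cluster_point:
  fixes u :: "nat \<Rightarrow> int \<Rightarrow> 'a::finite"
  obtains x where "\<And>n. \<exists>m\<ge>n. agree n (u m) x"
proof -
  let ?C = "\<lambda>n. seq_topology closure_of (u ` {n..})"
  have "compact_space (seq_topology :: (int \<Rightarrow> 'a) topology)"
    unfolding seq_topology_def
    by (simp add: compact_space_product_topology compact_space_discrete_topology)
  then have "(\<Inter>n. ?C n) \<noteq> {}"
  proof (rule compact_space_imp_nest)
    show "closedin seq_topology (?C n)" for n by simp
    show "?C n \<noteq> {}" for n
      by (simp add: closure_of_eq_empty)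
    show "decseq ?C"
      by (rule decseq_SucI) (auto intro!: closure_of_mono)
  qed
  then obtain x where x: "\<And>n. x \<in> ?C n" by auto
  have "\<exists>m\<ge>n. agree n (u m) x" for n
  proof -
    have "\<exists>y. y \<in> u ` {n..} \<and> y \<in> {y. agree n x y}"
      using x[of n] openin_agree[of n x] unfolding in_closure_of
      by (metis (no_types, lifting) agree_refl mem_Collect_eq)
    then show ?thesis by (auto intro: agree_sym)
  qed
  then show thesis by (rule that)
qed

lemma cluster_point_in:
  fixes u :: "nat \<Rightarrow> int \<Rightarrow> 'a::finite"
  assumes "closedin seq_topology X" "\<And>n. u n \<in> X"
  obtains x where "x \<in> X" "\<And>n. \<exists>m\<ge>n. agree n (u m) x"
proof -
  obtain x where x: "\<And>n. \<exists>m\<ge>n. agree n (u m) x" by (rule cluster_point[of u]) blast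
  have "x \<in> X"
    using x assms(2) by (intro closedin_agree_limit[OF assms(1)]) (meson agree_sym)
  then show thesis using x that by blast
qed

section \<open>Shift spaces and dense orbits in terms of windows\<close>

definition dense_orbit :: "(int \<Rightarrow> 'a) set \<Rightarrow> (int \<Rightarrow> 'a) \<Rightarrow> bool" where
  "dense_orbit X x \<longleftrightarrow> (\<forall>z\<in>X. \<forall>n. \<exists>k. agree n z (shift_power k x))"

locale shift_space =
  fixes X :: "(int \<Rightarrow> 'a::finite) set"
  assumes shift: "is_shift X"
begin

lemma closed: "closedin seq_topology X"
  using shift by (simp add: is_shift_def)

lemma shift_power_in_iff [simp]: "shift_power k x \<in> X \<longleftrightarrow> x \<in> X"
proof -
  have im: "left_shift ` X = X" using shift by (simp add: is_shift_def)
  have left: "left_shift y \<in> X \<longleftrightarrow> y \<in> X" for y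
  proof
    \<comment> \<open>\<open>left_shift\<close> is injective on all sequences, so the preimage in
      \<open>X\<close> that \<open>im\<close> provides is \<open>y\<close> itself.\<close>
    assume "left_shift y \<in> X"
    then obtain z where z: "z \<in> X" "left_shift y = left_shift z" using im by (metis imageE)
    have "y i = z i" for i
      using fun_cong[OF z(2), of "i - 1"] by (simp add: left_shift_def)
    then have "y = z" ..
    then show "y \<in> X" using z by simp
  qed (use im in blast)
  have one: "shift_power (l + 1) x \<in> X \<longleftrightarrow> shift_power l x \<in> X" for l x
    using left[of "shift_power l x"] by (simp add: shift_power_1[symmetric] add.commute)
  show ?thesis
  proof (induction k rule: int_induct[where k = 0])
    case (step2 i)
    then show ?case using one[of "i - 1" x] by simp
  qed (simp_all add: one)
qed

lemma dense_orbit_iff: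
  assumes "x \<in> X"
  shows "dense_orbit X x \<longleftrightarrow> subtopology seq_topology X closure_of shift_orbit x = X"
proof -
  have sub: "shift_orbit x \<subseteq> X" using assms by (auto simp: shift_orbit_def)
  have "z \<in> seq_topology closure_of shift_orbit x \<longleftrightarrow>
      (\<forall>n. \<exists>k. agree n z (shift_power k x))" for z
  proof
    assume z: "z \<in> seq_topology closure_of shift_orbit x"
    show "\<forall>n. \<exists>k. agree n z (shift_power k x)"
    proof
      fix n
      have "\<exists>y. y \<in> shift_orbit x \<and> y \<in> {y. agree n z y}"
        using z openin_agree[of n z] unfolding in_closure_of
        by (metis (no_types, lifting) agree_refl mem_Collect_eq)
      then show "\<exists>k. agree n z (shift_power k x)" by (auto simp: shift_orbit_def)
    qed
  next
    assume ag: "\<forall>n. \<exists>k. agree n z (shift_power k x)"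
    have "\<exists>y. y \<in> shift_orbit x \<and> y \<in> U" if "z \<in> U" "openin seq_topology U" for U
    proof -
      obtain n where "\<And>y. agree n z y \<Longrightarrow> y \<in> U"
        using openin_seq_topology_agree \<open>openin seq_topology U\<close> \<open>z \<in> U\<close> by metis
      then show ?thesis using ag unfolding shift_orbit_def by blast
    qed
    then show "z \<in> seq_topology closure_of shift_orbit x" by (simp add: in_closure_of)
  qed
  then have "subtopology seq_topology X closure_of shift_orbit x =
      {z \<in> X. \<forall>n. \<exists>k. agree n z (shift_power k x)}"
    using sub by (auto simp: closure_of_subtopology Int_absorb1)
  then show ?thesis unfolding dense_orbit_def by blast
qed

end

section \<open>Words and the complexity function\<close>

definition word :: "int \<Rightarrow> nat \<Rightarrow> (int \<Rightarrow> 'a) \<Rightarrow> 'a list" where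
  "word a n x = map (\<lambda>t. x (a + int t)) [0..<n]"

lemma word_eq_iff: "word a n x = word a n y \<longleftrightarrow> (\<forall>i. a \<le> i \<and> i < a + int n \<longrightarrow> x i = y i)"
proof
  assume eq: "word a n x = word a n y"
  have "x i = y i" if "a \<le> i" "i < a + int n" for i
  proof -
    have "nat (i - a) \<in> set [0..<n]" using that by auto
    then have "x (a + int (nat (i - a))) = y (a + int (nat (i - a)))"
      using eq unfolding word_def map_eq_conv by blast
    then show ?thesis using that by simp
  qed
  then show "\<forall>i. a \<le> i \<and> i < a + int n \<longrightarrow> x i = y i" by blast
qed (auto simp: word_def)

lemma length_word [simp]: "length (word a n x) = n"
  by (simp add: word_def)

lemma word_Suc: "word a (Suc n) x = word a n x @ [x (a + int n)]"
  by (simp add: word_def)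

lemma finite_words [simp]: "finite (word a n ` (Y :: (int \<Rightarrow> 'a::finite) set))"
proof -
  have "finite {w :: 'a list. set w \<subseteq> UNIV \<and> length w = n}"
    by (rule finite_lists_length_eq) simp
  then show ?thesis by (rule finite_subset[rotated]) auto
qed

text \<open>Shift invariance frees the position at which words are read: words starting at 0 suit
  the counting of windows, words ending at -1 or 0 the study of pasts.\<close>

lemma (in shift_space) complexity_eq: "complexity X n = card (word a n ` X)"
proof -
  have "{w. length w = n \<and> (\<exists>x\<in>X. \<forall>i<n. x (int i) = w ! i)} = word a n ` X"
  proof (intro equalityI subsetI)
    fix w assume "w \<in> {w. length w = n \<and> (\<exists>x\<in>X. \<forall>i<n. x (int i) = w ! i)}"
    then obtain x where x: "length w = n" "x \<in> X" "\<And>i. i < n \<Longrightarrow> x (int i) = w ! i" by auto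
    have "w = word a n (shift_power (- a) x)"
      by (rule nth_equalityI) (auto simp: x word_def shift_power_def)
    then show "w \<in> word a n ` X" using x(2) by auto
  next
    fix w assume "w \<in> word a n ` X"
    then obtain x where x: "x \<in> X" "w = word a n x" by auto
    then have "shift_power a x \<in> X" by simp
    moreover have "\<forall>i<n. shift_power a x (int i) = w ! i"
      using x(2) by (auto simp: word_def shift_power_def add.commute)
    ultimately show "w \<in> {w. length w = n \<and> (\<exists>x\<in>X. \<forall>i<n. x (int i) = w ! i)}"
      using x(2) by auto
  qed
  then show ?thesis by (simp add: complexity_def)
qed

lemma (in shift_space) card_le_complexity:
  assumes "\<And>i. i \<in> I \<Longrightarrow> z i \<in> X" and "inj_on (\<lambda>i. word 0 n (z i)) I"
  shows "card I \<le> complexity X n"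
proof -
  have "card ((\<lambda>i. word 0 n (z i)) ` I) \<le> card (word 0 n ` X)"
    using assms(1) by (intro card_mono) auto
  then show ?thesis by (simp add: complexity_eq[of n 0] card_image[OF assms(2)])
qed

section \<open>Recurrence in a direction \<open>e\<close>, and counting non-recurrent orbits\<close>

definition recurrent :: "int \<Rightarrow> (int \<Rightarrow> 'a) \<Rightarrow> bool" where
  "recurrent e x \<longleftrightarrow> (\<forall>n. \<exists>k::nat. 0 < k \<and> agree n (shift_power (e * int k) x) x)"

lemma not_recurrentE:
  assumes "\<not> recurrent e x"
  obtains n where "\<And>k::nat. 0 < k \<Longrightarrow> \<not> agree n (shift_power (e * int k) x) x"
  using assms unfolding recurrent_def by blast

lemma shift_orbit_shift_power [simp]: "shift_orbit (shift_power k x) = shift_orbit x"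
proof -
  have "\<exists>m. shift_power n x = shift_power (m + k) x" for n
    by (rule exI[of _ "n - k"]) simp
  then show ?thesis by (auto simp: shift_orbit_def)
qed

text \<open>Occurrences of \<open>y\<close> far out in the direction \<open>e\<close> of \<open>x\<close> and of \<open>x\<close> in \<open>y\<close> on the opposite
  side combine to a return of \<open>x\<close> to itself.\<close>

lemma not_recurrent_separated_half:
  assumes e: "e \<in> {1, -1}" and nr: "\<not> recurrent e x" and ne: "shift_orbit x \<noteq> shift_orbit y"
  shows "\<exists>J. \<forall>d::nat. \<not> (agree J (shift_power (e * int d) x) y \<and>
                       agree J (shift_power (- e * int d) y) x)"
proof -
  obtain n where n: "\<And>k::nat. 0 < k \<Longrightarrow> \<not> agree n (shift_power (e * int k) x) x"
    using nr by (rule not_recurrentE) blast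
  show ?thesis
  proof (cases "\<exists>d::nat. agree n (shift_power (- e * int d) y) x")
    case False
    then show ?thesis by blast
  next
    case True
    then obtain d0 where d0: "agree n (shift_power (- e * int d0) y) x" by blast
    \<comment> \<open>The orbits differ, so each single \<open>d\<close> is excluded by some window,
      and the finitely many \<open>d\<close> up to \<open>d0\<close> by a common one.\<close>
    have "\<exists>J. \<not> agree J (shift_power (e * int d) x) y" for d
    proof (rule ccontr)
      assume "\<not> ?thesis"
      then have y: "y = shift_power (e * int d) x" by (metis agree_all_imp_eq)
      show False using ne unfolding y by simp
    qed
    then have "\<forall>d. \<forall>\<^sub>F J in sequentially. \<not> agree J (shift_power (e * int d) x) y"
      unfolding eventually_sequentially by (meson agree_mono)
    then have "\<forall>\<^sub>F J in sequentially. (\<forall>d\<in>{..d0}. \<not> agree J (shift_power (e * int d) x) y) \<and> J \<ge> d0 + n"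
      by (intro eventually_conj eventually_ball_finite eventually_ge_at_top) auto
    then obtain J where J: "\<And>d. d \<le> d0 \<Longrightarrow> \<not> agree J (shift_power (e * int d) x) y" "J \<ge> d0 + n"
      unfolding eventually_sequentially by auto
    \<comment> \<open>Only \<open>d > d0\<close> remains. Going from \<open>x\<close> by
      \<open>d\<close> near \<open>y\<close> and back by \<open>d0\<close> near \<open>x\<close> is
      a return of \<open>x\<close> after \<open>d - d0\<close> steps; \<open>J\<close> exceeds
      \<open>n\<close> by enough to allow the shift by \<open>d0\<close>.\<close>
    have False if d: "agree J (shift_power (e * int d) x) y" for d
    proof -
      have "d0 < d" using J(1)[of d] d by (meson not_le)
      have "agree n (shift_power (- e * int d0) (shift_power (e * int d) x)) (shift_power (- e * int d0) y)"
        using d by (rule agree_shift) (use e J(2) in auto)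
      then have "agree n (shift_power (- e * int d0) (shift_power (e * int d) x)) x"
        using d0 by (rule agree_trans)
      also have "shift_power (- e * int d0) (shift_power (e * int d) x) = shift_power (e * int (d - d0)) x"
        using \<open>d0 < d\<close> by (simp add: of_nat_diff algebra_simps)
      finally show False using n[of "d - d0"] \<open>d0 < d\<close> by simp
    qed
    then show ?thesis by blast
  qed
qed

text \<open>Both agreements arise when one word shows \<open>x\<close> and \<open>y\<close> with
  origins \<open>d\<close> apart, so a large \<open>J\<close> leaves only the trivial overlap. For
  \<open>x = y\<close> one of \<open>d\<close> and \<open>- d\<close> points in direction
  \<open>e\<close> and would be a return; for different orbits the sign of \<open>d * e\<close>
  decides which of the two points plays the first role in
  \<open>not_recurrent_separated_half\<close>.\<close>

lemma not_recurrent_separated: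
  assumes e: "e \<in> {1, -1}" and nr: "\<not> recurrent e x" "\<not> recurrent e y"
    and inj: "shift_orbit x = shift_orbit y \<Longrightarrow> x = y"
  shows "\<forall>\<^sub>F J in sequentially. \<forall>d. agree J (shift_power d x) y \<and> agree J (shift_power (- d) y) x
            \<longrightarrow> x = y \<and> d = 0"
proof -
  have "\<exists>J. \<forall>d. agree J (shift_power d x) y \<and> agree J (shift_power (- d) y) x
            \<longrightarrow> x = y \<and> d = 0"
  proof (cases "x = y")
    case True
    obtain n where n: "\<And>k::nat. 0 < k \<Longrightarrow> \<not> agree n (shift_power (e * int k) x) x"
      using nr(1) by (rule not_recurrentE) blast
    have "d = 0" if "agree n (shift_power d x) x" "agree n (shift_power (- d) x) x" for d
    proof (rule ccontr)
      assume "d \<noteq> 0"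
      then have "e * int (nat \<bar>d\<bar>) \<in> {d, - d}" using e by auto
      then show False using n[of "nat \<bar>d\<bar>"] that \<open>d \<noteq> 0\<close> by auto
    qed
    then show ?thesis using True by blast
  next
    case False
    then have ne: "shift_orbit x \<noteq> shift_orbit y" using inj by blast
    obtain J1 where J1: "\<And>d::nat. \<not> (agree J1 (shift_power (e * int d) x) y \<and>
                       agree J1 (shift_power (- e * int d) y) x)"
      using not_recurrent_separated_half[OF e nr(1) ne] by blast
    obtain J2 where J2: "\<And>d::nat. \<not> (agree J2 (shift_power (e * int d) y) x \<and>
                       agree J2 (shift_power (- e * int d) x) y)"
      using not_recurrent_separated_half[OF e nr(2) ne[symmetric]] by blast
    have False if d: "agree (max J1 J2) (shift_power d x) y" "agree (max J1 J2) (shift_power (- d) y) x" for d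
    proof (cases "d * e \<ge> 0")
      case True
      then have "e * int (nat \<bar>d\<bar>) = d" using e by auto
      then show False using J1[of "nat \<bar>d\<bar>"] d by (metis agree_mono max.cobounded1 minus_mult_left)
    next
      case False
      then have "e * int (nat \<bar>d\<bar>) = - d" using e by auto
      then show False using J2[of "nat \<bar>d\<bar>"] d
        by (metis agree_mono max.cobounded2 minus_mult_left minus_minus)
    qed
    then show ?thesis by blast
  qed
  then show ?thesis
    unfolding eventually_sequentially by (meson agree_mono)
qed

locale linear_shift = shift_space +
  fixes K :: nat
  assumes linear: "\<forall>\<^sub>F n in sequentially. complexity X n \<le> K * n"
begin

lemma card_not_recurrent_le:
  assumes e: "e \<in> {1, -1}" and F: "finite F" "F \<subseteq> {x \<in> X. \<not> recurrent e x}" "inj_on shift_orbit F"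
  shows "card F \<le> K"
proof -
  have "\<forall>\<^sub>F J in sequentially. \<forall>x\<in>F. \<forall>y\<in>F. \<forall>d. agree J (shift_power d x) y \<and> agree J (shift_power (- d) y) x
            \<longrightarrow> x = y \<and> d = 0"
  proof (rule eventually_ball_finite[OF F(1)], rule ballI, rule eventually_ball_finite[OF F(1)], rule ballI)
    fix x y assume xy: "x \<in> F" "y \<in> F"
    show "\<forall>\<^sub>F J in sequentially. \<forall>d. agree J (shift_power d x) y \<and> agree J (shift_power (- d) y) x
            \<longrightarrow> x = y \<and> d = 0"
    proof (rule not_recurrent_separated[OF e])
      show "\<not> recurrent e x" "\<not> recurrent e y" using F(2) xy by auto
      show "x = y" if "shift_orbit x = shift_orbit y" using F(3) that xy by (rule inj_onD)
    qed
  qed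
  then have "\<exists>J. \<forall>x\<in>F. \<forall>y\<in>F. \<forall>d. agree J (shift_power d x) y \<and> agree J (shift_power (- d) y) x
            \<longrightarrow> x = y \<and> d = 0"
    by (rule eventually_happens'[OF sequentially_bot])
  then obtain J where J: "\<forall>x\<in>F. \<forall>y\<in>F. \<forall>d. agree J (shift_power d x) y \<and> agree J (shift_power (- d) y) x
            \<longrightarrow> x = y \<and> d = 0" ..
  \<comment> \<open>\<open>shift_power (- int j) x\<close> puts the origin of \<open>x\<close> at
    position \<open>j\<close>. For \<open>j\<close> in \<open>{J..<N - J}\<close> the window of
    radius \<open>J\<close> around it lies inside the word of length \<open>N\<close>, so equal
    words give the two agreements that \<open>J\<close> excludes.\<close>
  have le: "card F * (N - 2 * J) \<le> complexity X N" for N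
  proof -
    have "card (F \<times> {J..<N - J}) \<le> complexity X N"
    proof (rule card_le_complexity[where z = "\<lambda>(x, j). shift_power (- int j) x"])
      fix p assume "p \<in> F \<times> {J..<N - J}"
      then show "(case p of (x, j) \<Rightarrow> shift_power (- int j) x) \<in> X" using F by auto
    next
      show "inj_on (\<lambda>p. word 0 N (case p of (x, j) \<Rightarrow> shift_power (- int j) x)) (F \<times> {J..<N - J})"
      proof (rule inj_onI)
        fix p q assume p: "p \<in> F \<times> {J..<N - J}" and q: "q \<in> F \<times> {J..<N - J}"
          and eq: "word 0 N (case p of (x, j) \<Rightarrow> shift_power (- int j) x)
            = word 0 N (case q of (x, j) \<Rightarrow> shift_power (- int j) x)"
        obtain x j where [simp]: "p = (x, j)" by (cases p)
        obtain y l where [simp]: "q = (y, l)" by (cases q)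
        have j: "J \<le> j" "j < N - J" and l: "J \<le> l" "l < N - J" and xy: "x \<in> F" "y \<in> F" using p q by auto
        have eq': "x (t - int j) = y (t - int l)" if "0 \<le> t" "t < int N" for t
          using eq that by (auto simp: word_eq_iff shift_power_def)
        have "agree J (shift_power (int l - int j) x) y"
          unfolding agree_def shift_power_def
        proof (intro allI impI)
          fix i assume "\<bar>i\<bar> \<le> int J"
          then show "x (i + (int l - int j)) = y i" using eq'[of "i + int l"] l by (auto simp: algebra_simps)
        qed
        moreover have "agree J (shift_power (- (int l - int j)) y) x"
          unfolding agree_def shift_power_def
        proof (intro allI impI)
          fix i assume "\<bar>i\<bar> \<le> int J"
          then show "y (i + - (int l - int j)) = x i" using eq'[of "i + int j"] j by (auto simp: algebra_simps)
        qed
        ultimately have "x = y \<and> int l - int j = 0"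
          using J[rule_format, OF xy, of "int l - int j"] by simp
        then show "p = q" by simp
      qed
    qed
    then show ?thesis by (simp add: card_cartesian_product mult_2)
  qed
  \<comment> \<open>If \<open>card F\<close> were at least \<open>K + 1\<close>, the bounds would
    give \<open>(K + 1) * (N - 2 * J) \<le> K * N\<close>, that is
    \<open>N \<le> 2 * J * (K + 1)\<close>.\<close>
  obtain N where N: "complexity X N \<le> K * N" "N > 2 * J * (K + 1)"
    using eventually_conj[OF linear eventually_gt_at_top[of "2 * J * (K + 1)"]]
    by (auto dest: eventually_happens'[OF sequentially_bot])
  show ?thesis
  proof (rule ccontr)
    assume "\<not> ?thesis"
    then have "(K + 1) * (N - 2 * J) \<le> card F * (N - 2 * J)" by (intro mult_le_mono1) simp
    also have "\<dots> \<le> K * N" using le[of N] N(1) by simp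
    finally have *: "(K + 1) * (N - 2 * J) \<le> K * N" .
    have "2 * J \<le> 2 * J * (K + 1)" by simp
    then have "2 * J \<le> N" using N(2) by linarith
    then obtain M where "N = 2 * J + M" using le_Suc_ex by blast
    then show False using N(2) * by (simp add: algebra_simps)
  qed
qed

lemma finite_orbits_not_recurrent:
  assumes "e \<in> {1, -1}"
  shows "finite (shift_orbit ` {x \<in> X. \<not> recurrent e x})"
proof (rule ccontr)
  assume "\<not> ?thesis"
  then obtain T where T: "finite T" "card T = Suc K" "T \<subseteq> shift_orbit ` {x \<in> X. \<not> recurrent e x}"
    using infinite_arbitrarily_large by blast
  then obtain F where F: "F \<subseteq> {x \<in> X. \<not> recurrent e x}" "inj_on shift_orbit F" "T = shift_orbit ` F"
    by (auto simp: subset_image_inj)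
  then have "finite F" using T(1) finite_imageD by blast
  then have "card F \<le> K" using card_not_recurrent_le[OF assms] F by blast
  then show False using T(2) F by (simp add: card_image)
qed

end

section \<open>A non-recurrent point with dense orbit\<close>

lemma uniform_direction:
  fixes A :: "int \<Rightarrow> nat \<Rightarrow> bool"
  assumes "\<And>n. A 1 n \<or> A (- 1) n" and "\<And>e m n. A e n \<Longrightarrow> m \<le> n \<Longrightarrow> A e m"
  shows "\<exists>e\<in>{1, - 1}. \<forall>n. A e n"
proof (cases "\<forall>n. A 1 n")
  case False
  then obtain n where n: "\<not> A 1 n" by blast
  \<comment> \<open>From \<open>n\<close> on only the direction -1 is possible, and monotonicity
    carries it down to every \<open>m\<close>.\<close>
  have "A (- 1) m" for m
    using assms(1)[of "max m n"] assms(2)[of 1 "max m n" n] assms(2)[of "- 1" "max m n" m] n by auto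
  then show ?thesis by blast
qed blast

text \<open>Around position \<open>e * q\<close> the point \<open>x\<close> copies \<open>z\<close>,
  where the \<open>m\<close>-window of \<open>x\<close> never occurs. Take the last occurrence
  \<open>i\<close> up to \<open>q\<close>; 0 is one. The next \<open>L\<close> positions are free of
  it: those up to \<open>q\<close> by maximality, the others because they are at most
  \<open>L\<close> beyond \<open>q\<close>, where the copy of \<open>z\<close> still
  decides.\<close>

lemma last_occurrence_before_gap:
  assumes m: "agree (m + L) z (shift_power (e * int q) x)" and z: "\<And>k. \<not> agree m x (shift_power k z)"
    and e: "e \<in> {1, - 1}"
  shows "\<exists>i::nat. agree m x (shift_power (e * int i) x) \<and>
      (\<forall>k. 0 < k \<and> k \<le> L \<longrightarrow> \<not> agree m x (shift_power (e * int (i + k)) x))"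
proof -
  define S where "S = {i. i \<le> q \<and> agree m x (shift_power (e * int i) x)}"
  have S: "finite S" "0 \<in> S" by (auto simp: S_def)
  define i where "i = Max S"
  have i: "i \<in> S" unfolding i_def using S by (intro Max_in) auto
  have "\<not> agree m x (shift_power (e * int (i + k)) x)" if k: "0 < k" "k \<le> L" for k
  proof
    assume ag: "agree m x (shift_power (e * int (i + k)) x)"
    have "\<not> i + k \<le> q"
    proof
      assume "i + k \<le> q"
      then have "i + k \<in> S" using ag by (simp add: S_def)
      then show False using Max_ge[OF S(1), of "i + k"] k by (simp add: i_def)
    qed
    define t where "t = i + k - q"
    have t: "i + k = q + t" "t \<le> L" using \<open>\<not> i + k \<le> q\<close> k i by (auto simp: t_def S_def)
    have "agree m (shift_power (e * int t) z) (shift_power (e * int t) (shift_power (e * int q) x))"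
      using m by (rule agree_shift) (use e t(2) in auto)
    moreover have "e * int t + e * int q = e * int (i + k)"
      using t(1) by (simp add: algebra_simps)
    ultimately have "agree m (shift_power (e * int t) z) (shift_power (e * int (i + k)) x)" by simp
    then show False using z[of "e * int t"] ag by (meson agree_sym agree_trans)
  qed
  then show ?thesis using i by (auto simp: S_def)
qed

context shift_space
begin

text \<open>Copies of ever longer stretches of \<open>z\<close> in \<open>x\<close> yield gaps of
  every length \<open>L\<close> in one direction. A cluster point of \<open>x\<close> recentred at
  the starts of these gaps shows the \<open>m\<close>-window of \<open>x\<close> at the origin and
  never again in that direction.\<close>

lemma not_recurrent_near_dense:
  assumes x: "x \<in> X" "dense_orbit X x" and z: "z \<in> X" "\<And>k. \<not> agree m x (shift_power k z)"
  shows "\<exists>e\<in>{1, -1}. \<exists>y\<in>X. \<not> recurrent e y \<and> agree m x y"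
proof -
  define Q where "Q e L \<longleftrightarrow> (\<exists>i::nat. agree m x (shift_power (e * int i) x) \<and>
      (\<forall>k. 0 < k \<and> k \<le> L \<longrightarrow> \<not> agree m x (shift_power (e * int (i + k)) x)))" for e L
  have "Q 1 L \<or> Q (- 1) L" for L
  proof -
    obtain p where p: "agree (m + L) z (shift_power p x)"
      using x(2) z(1) unfolding dense_orbit_def by blast
    show ?thesis
    proof (cases "p \<ge> 0")
      case True
      then show ?thesis
        using last_occurrence_before_gap[of m L z 1 "nat p" x] p z(2) by (simp add: Q_def)
    next
      case False
      then show ?thesis
        using last_occurrence_before_gap[of m L z "- 1" "nat (- p)" x] p z(2) by (simp add: Q_def)
    qed
  qed
  moreover have "Q e m" if "Q e n" "m \<le> n" for e m n
    using that unfolding Q_def by (meson le_trans)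
  ultimately have "\<exists>e\<in>{1, - 1}. \<forall>L. Q e L"
    by (rule uniform_direction)
  then obtain e where e: "e \<in> {1, - 1}" "\<And>L. Q e L" by blast
  have "\<exists>i. \<forall>L. agree m x (shift_power (e * int (i L)) x) \<and>
      (\<forall>k. 0 < k \<and> k \<le> L \<longrightarrow> \<not> agree m x (shift_power (e * int (i L + k)) x))"
    using e(2) unfolding Q_def by metis
  then obtain i where i: "\<And>L. agree m x (shift_power (e * int (i L)) x)"
    "\<And>L k. 0 < k \<Longrightarrow> k \<le> L \<Longrightarrow> \<not> agree m x (shift_power (e * int (i L + k)) x)"
    by blast
  obtain y where y: "y \<in> X" "\<And>n. \<exists>L\<ge>n. agree n (shift_power (e * int (i L)) x) y"
    by (rule cluster_point_in[OF closed, of "\<lambda>L. shift_power (e * int (i L)) x"]) (use x(1) in auto)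
  have xy: "agree m x y"
    using y(2)[of m] i(1) agree_trans by blast
  have nr: "\<not> agree m x (shift_power (e * int k) y)" if k: "0 < k" for k :: nat
  proof
    assume ag: "agree m x (shift_power (e * int k) y)"
    \<comment> \<open>Index \<open>m + k\<close> gives a gap of length at least \<open>k\<close> and
      a window with room for the shift by \<open>k\<close>.\<close>
    obtain L where L: "L \<ge> m + k" "agree (m + k) (shift_power (e * int (i L)) x) y"
      using y(2) by blast
    have "agree m (shift_power (e * int k) (shift_power (e * int (i L)) x)) (shift_power (e * int k) y)"
      using L(2) by (rule agree_shift) (use e(1) in auto)
    moreover have "e * int k + e * int (i L) = e * int (i L + k)" by (simp add: algebra_simps)
    ultimately have "agree m (shift_power (e * int (i L + k)) x) (shift_power (e * int k) y)" by simp
    then have "agree m x (shift_power (e * int (i L + k)) x)"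
      using ag by (meson agree_sym agree_trans)
    then show False using i(2)[of k L] k L(1) by simp
  qed
  have "\<not> recurrent e y"
    unfolding recurrent_def using nr xy by (meson agree_sym agree_trans)
  then show ?thesis using e(1) y(1) xy by blast
qed

end

context linear_shift
begin

text \<open>Non-recurrent points approximate \<open>x\<close> arbitrarily well but lie on finitely
  many orbits. One of these orbits contains infinitely many of the approximations, so it comes
  arbitrarily close to \<open>x\<close> and is dense as well.\<close>

lemma dense_not_recurrent_exists:
  assumes x: "x \<in> X" "dense_orbit X x" and z: "z \<in> X" "\<not> dense_orbit X z"
  obtains e y where "e \<in> {1, - 1}" "y \<in> X" "dense_orbit X y" "\<not> recurrent e y"
proof -
  obtain w n where w: "w \<in> X" "\<And>k. \<not> agree n w (shift_power k z)"
    using z(2) unfolding dense_orbit_def by blast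
  obtain l where l: "agree n w (shift_power l x)" using x(2) w(1) unfolding dense_orbit_def by blast
  \<comment> \<open>The word missed by the orbit of \<open>z\<close> is a window of
    \<open>w\<close>, not of \<open>x\<close>; it occurs in \<open>x\<close> at \<open>l\<close>, so
    any central window of \<open>x\<close> reaching past that occurrence is missed too.\<close>
  have far: "\<not> agree m x (shift_power k z)" if "n + nat \<bar>l\<bar> \<le> m" for m k
  proof
    assume "agree m x (shift_power k z)"
    then have "agree n (shift_power l x) (shift_power l (shift_power k z))"
      by (rule agree_shift) (use that in auto)
    then show False using w(2)[of "l + k"] l agree_trans by force
  qed
  define R where "R e m \<longleftrightarrow> (\<exists>y\<in>X. \<not> recurrent e y \<and> agree m x y)" for e m
  have mono: "R e m" if "R e n" "m \<le> n" for e m n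
    using that unfolding R_def by (meson agree_mono)
  have "R 1 m \<or> R (- 1) m" for m
    using not_recurrent_near_dense[OF x z(1) far, of "m + (n + nat \<bar>l\<bar>)"] mono[of _ "m + (n + nat \<bar>l\<bar>)" m]
    unfolding R_def[symmetric] by auto
  then have "\<exists>e\<in>{1, - 1}. \<forall>m. R e m"
    using mono by (rule uniform_direction)
  then obtain e where e: "e \<in> {1, - 1}" "\<And>m. R e m" by blast
  then obtain y where y: "\<And>m. y m \<in> X \<and> \<not> recurrent e (y m) \<and> agree m x (y m)"
    unfolding R_def by metis
  have "finite ((\<lambda>m. shift_orbit (y m)) ` UNIV)"
    using finite_orbits_not_recurrent[OF e(1)] by (rule finite_subset[rotated]) (use y in auto)
  then obtain m0 where m0: "infinite {m. shift_orbit (y m) = shift_orbit (y m0)}"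
    using pigeonhole_infinite[of UNIV "\<lambda>m. shift_orbit (y m)"] by auto
  have "dense_orbit X (y m0)"
    unfolding dense_orbit_def
  proof (intro ballI allI)
    fix v n assume "v \<in> X"
    then obtain k where k: "agree n v (shift_power k x)" using x(2) unfolding dense_orbit_def by blast
    obtain m where m: "m \<ge> n + nat \<bar>k\<bar>" "shift_orbit (y m) = shift_orbit (y m0)"
      using m0 unfolding infinite_nat_iff_unbounded_le by blast
    have "y m \<in> shift_orbit (y m)" unfolding shift_orbit_def by (metis (mono_tags) mem_Collect_eq shift_power_zero)
    then obtain j where j: "y m = shift_power j (y m0)" unfolding m(2) by (auto simp: shift_orbit_def)
    have "agree m x (y m)" using y by blast
    then have "agree n (shift_power k x) (shift_power k (y m))"
      by (rule agree_shift) (use m(1) in auto)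
    then have "agree n v (shift_power (k + j) (y m0))" using k j agree_trans by fastforce
    then show "\<exists>k. agree n v (shift_power k (y m0))" ..
  qed
  then show thesis using that e(1) y by blast
qed

end

section \<open>Branching pasts and left asymptotic points\<close>

definition past :: "(int \<Rightarrow> 'a) \<Rightarrow> nat \<Rightarrow> 'a" where
  "past x j = x (- int j - 1)"

lemma past_eq_iff: "past x = past y \<longleftrightarrow> (\<forall>i<0. x i = y i)"
proof
  assume eq: "past x = past y"
  have "x i = y i" if "i < 0" for i
    using fun_cong[OF eq, of "nat (- i - 1)"] that by (simp add: past_def)
  then show "\<forall>i<0. x i = y i" by blast
qed (auto simp: past_def)

text \<open>The pasts of these points are the left-infinite counterparts of right special
  words.\<close>

definition branching :: "(int \<Rightarrow> 'a) set \<Rightarrow> (int \<Rightarrow> 'a) set" where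
  "branching X = {x \<in> X. \<exists>y\<in>X. past x = past y \<and> x 0 \<noteq> y 0}"

definition asymptotic :: "(int \<Rightarrow> 'a) set \<Rightarrow> (int \<Rightarrow> 'a) \<Rightarrow> bool" where
  "asymptotic X x \<longleftrightarrow> (\<exists>y\<in>X. y \<noteq> x \<and> (\<exists>t. \<forall>i<t. x i = y i))"

definition aperiodic :: "(int \<Rightarrow> 'a) \<Rightarrow> bool" where
  "aperiodic x \<longleftrightarrow> (\<forall>d::nat. 0 < d \<longrightarrow> shift_power (int d) x \<noteq> x)"

text \<open>Each branching point contributes a right special word of every length.\<close>

lemma (in shift_space) complexity_Suc_ge:
  assumes T: "T \<subseteq> branching X" "inj_on (word (- int n) n) T"
  shows "complexity X n + card T \<le> complexity X (Suc n)"
proof -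
  let ?w = "word (- int n) n" and ?w' = "word (- int n) (Suc n)"
  have bl: "butlast (?w' x) = ?w x" for x by (simp add: word_Suc)
  \<comment> \<open>\<open>g\<close> picks one extension of each word of length \<open>n\<close>,
    and \<open>h\<close> below a second one for the word of each point of \<open>T\<close>. Deleting
    the last letter recovers the word, whence injectivity and disjointness.\<close>
  define g where "g v = ?w' (inv_into X ?w v)" for v
  have g: "butlast (g v) = v" "g v \<in> ?w' ` X" if "v \<in> ?w ` X" for v
    using that by (auto simp: g_def bl f_inv_into_f inv_into_into)
  have "\<exists>v \<in> ?w' ` X. butlast v = ?w x \<and> v \<noteq> g (?w x)" if xT: "x \<in> T" for x
  proof -
    obtain y where y: "x \<in> X" "y \<in> X" "past x = past y" "x 0 \<noteq> y 0"
      using T(1) xT unfolding branching_def by blast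
    then have "?w x = ?w y" by (simp add: past_eq_iff word_eq_iff)
    moreover have "?w' x \<noteq> ?w' y" using y(4) by (auto simp: word_Suc)
    ultimately show ?thesis using y(1,2) bl by (metis image_eqI)
  qed
  then obtain h where h: "\<And>x. x \<in> T \<Longrightarrow> h x \<in> ?w' ` X \<and> butlast (h x) = ?w x \<and> h x \<noteq> g (?w x)"
    by metis
  have inj_h: "inj_on h T"
    using h T(2) by (metis (no_types, lifting) inj_on_def)
  have inj_g: "inj_on g (?w ` X)"
    using g(1) by (metis inj_on_inverseI)
  have "g v \<noteq> h x" if "v \<in> ?w ` X" "x \<in> T" for v x
    using g(1)[OF that(1)] h[OF that(2)] by metis
  then have disj: "g ` ?w ` X \<inter> h ` T = {}" by blast
  have fin: "finite (?w ` X)" "finite (?w' ` X)" by simp_all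
  have finT: "finite (h ` T)"
    by (rule finite_subset[OF _ fin(2)]) (use h in blast)
  have "complexity X n + card T = card (g ` ?w ` X) + card (h ` T)"
    by (simp add: complexity_eq[of n "- int n"] card_image[OF inj_g] card_image[OF inj_h])
  also have "\<dots> = card (g ` ?w ` X \<union> h ` T)"
    using disj fin(1) finT by (intro card_Un_disjoint[symmetric]) simp_all
  also have "\<dots> \<le> card (?w' ` X)"
    using g(2) h fin(2) by (intro card_mono) auto
  finally show ?thesis by (simp add: complexity_eq[of "Suc n" "- int n"])
qed

lemma pasts_separated:
  assumes "finite T" "inj_on past T"
  shows "\<forall>\<^sub>F n in sequentially. inj_on (word (- int n) n) T"
proof -
  have sep: "\<forall>\<^sub>F n in sequentially. word (- int n) n x = word (- int n) n y \<longrightarrow> x = y"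
    if "x \<in> T" "y \<in> T" for x y
  proof (cases "x = y")
    case False
    then have "past x \<noteq> past y" using assms(2) that by (meson inj_onD)
    then obtain i where i: "i < 0" "x i \<noteq> y i" by (auto simp: past_eq_iff)
    have "\<not> word (- int n) n x = word (- int n) n y" if "n \<ge> nat (- i)" for n
      unfolding word_eq_iff using i that by (intro notI) (erule allE[of _ i], auto)
    then show ?thesis unfolding eventually_sequentially by blast
  qed simp
  have "\<forall>\<^sub>F n in sequentially. \<forall>x\<in>T. \<forall>y\<in>T. word (- int n) n x = word (- int n) n y \<longrightarrow> x = y"
    by (rule eventually_ball_finite[OF assms(1)], rule ballI,
        rule eventually_ball_finite[OF assms(1)], rule ballI, rule sep)
  then show ?thesis by (simp add: inj_on_def)
qed

lemma first_difference:
  fixes x y :: "int \<Rightarrow> 'a"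
  assumes "x \<noteq> y" "\<forall>i<t. x i = y i"
  obtains s where "s \<ge> t" "x s \<noteq> y s" "\<forall>i<s. x i = y i"
proof -
  obtain i where i: "x i \<noteq> y i" using assms(1) by (meson ext)
  then have "\<not> i < t" using assms(2) by blast
  then have "x (t + int (nat (i - t))) \<noteq> y (t + int (nat (i - t)))" using i by simp
  then have L: "x (t + int (LEAST k. x (t + int k) \<noteq> y (t + int k))) \<noteq> y (t + int (LEAST k. x (t + int k) \<noteq> y (t + int k)))"
    by (rule LeastI[where P = "\<lambda>k. x (t + int k) \<noteq> y (t + int k)"])
  define k where "k = (LEAST k. x (t + int k) \<noteq> y (t + int k))"
  have "x j = y j" if "j < t + int k" for j
  proof (cases "j < t")
    case False
    then have "nat (j - t) < k" using that by auto
    then have "x (t + int (nat (j - t))) = y (t + int (nat (j - t)))"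
      unfolding k_def using not_less_Least[where P = "\<lambda>k. x (t + int k) \<noteq> y (t + int k)"] by blast
    then show ?thesis using False by simp
  qed (use assms(2) in blast)
  then show thesis
    by (intro that[of "t + int k"]) (use L in \<open>simp_all add: k_def[symmetric]\<close>)
qed

lemma (in shift_space) branching_shiftI:
  assumes "x \<in> X" "y \<in> X" "x s \<noteq> y s" "\<forall>i<s. x i = y i"
  shows "shift_power s x \<in> branching X"
proof -
  have "past (shift_power s x) = past (shift_power s y)" "shift_power s x 0 \<noteq> shift_power s y 0"
    using assms(3,4) by (simp_all add: past_eq_iff shift_power_def)
  then show ?thesis unfolding branching_def using assms(1,2) by auto
qed

context linear_shift
begin

text \<open>\<open>K + 1\<close> branching points with distinct pasts would from some length on
  raise the complexity by at least \<open>K + 1\<close> at every step, faster than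
  \<open>K * n\<close> allows.\<close>

lemma finite_branching_pasts: "finite (past ` branching X)"
proof (rule ccontr)
  assume "\<not> ?thesis"
  then obtain P where P: "finite P" "card P = Suc K" "P \<subseteq> past ` branching X"
    using infinite_arbitrarily_large by blast
  then obtain T where T: "T \<subseteq> branching X" "inj_on past T" "P = past ` T"
    by (auto simp: subset_image_inj)
  have finT: "finite T" and cardT: "card T = Suc K"
    using P T finite_imageD by (blast, simp add: card_image)
  obtain n0 where n0: "\<And>n. n \<ge> n0 \<Longrightarrow> inj_on (word (- int n) n) T"
    using pasts_separated[OF finT T(2)] unfolding eventually_sequentially by blast
  have grow: "j * Suc K \<le> complexity X (n0 + j)" for j
  proof (induction j)
    case (Suc j)
    have "complexity X (n0 + j) + Suc K \<le> complexity X (Suc (n0 + j))"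
      using complexity_Suc_ge[OF T(1) n0, of "n0 + j"] cardT by simp
    then show ?case using Suc by simp
  qed simp
  obtain n1 where n1: "\<And>n. n \<ge> n1 \<Longrightarrow> complexity X n \<le> K * n"
    using linear unfolding eventually_sequentially by blast
  \<comment> \<open>The bounds would force \<open>j \<le> K * n0\<close>; the summand
    \<open>n1\<close> puts \<open>n0 + j\<close> in the range of the linear bound.\<close>
  define j where "j = n1 + K * n0 + 1"
  have "j * Suc K \<le> K * (n0 + j)"
    using grow[of j] n1[of "n0 + j"] by (simp add: j_def)
  then show False by (simp add: j_def algebra_simps)
qed

text \<open>There are finitely many branching pasts, so infinitely many branching times to the right
  would repeat one past at arbitrarily late times. This makes the whole point periodic.\<close>

lemma last_branching_time:
  assumes x: "x \<in> X" "aperiodic x" and s0: "shift_power s0 x \<in> branching X"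
  shows "\<exists>s. shift_power s x \<in> branching X \<and> (\<forall>k>0. shift_power k (shift_power s x) \<notin> branching X)"
proof -
  let ?S = "{k::nat. shift_power (s0 + int k) x \<in> branching X}"
  have "finite ?S"
  proof (rule ccontr)
    assume inf: "infinite ?S"
    have "finite ((\<lambda>k. past (shift_power (s0 + int k) x)) ` ?S)"
      using finite_branching_pasts by (rule finite_subset[rotated]) auto
    then obtain k0 where "infinite {k \<in> ?S. past (shift_power (s0 + int k) x) = past (shift_power (s0 + int k0) x)}"
      using pigeonhole_infinite[OF inf] by auto
    then have "infinite {k. past (shift_power (s0 + int k) x) = past (shift_power (s0 + int k0) x)}"
      by (rule infinite_super[rotated]) auto
    then have unb: "\<exists>k>m. past (shift_power (s0 + int k) x) = past (shift_power (s0 + int k0) x)" for m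
      unfolding infinite_nat_iff_unbounded by auto
    define a where "a = s0 + int k0"
    have copy: "\<exists>s>m. \<forall>i<0. x (s + i) = x (a + i)" for m
    proof -
      obtain k where "k > nat (m - s0)" "past (shift_power (s0 + int k) x) = past (shift_power (s0 + int k0) x)"
        using unb by blast
      then show ?thesis
        by (intro exI[of _ "s0 + int k"]) (auto simp: past_eq_iff shift_power_def a_def add.commute)
    qed
    obtain b where b: "b > a" "\<And>i. i < 0 \<Longrightarrow> x (b + i) = x (a + i)" using copy by blast
    \<comment> \<open>A copy ending at a late \<open>s\<close> moves both positions to the left:
      \<open>i\<close> to a place left of \<open>a\<close>, and \<open>i + (b - a)\<close> to the
      corresponding place left of \<open>b\<close>. The equal pasts at \<open>a\<close> and
      \<open>b\<close> then compare them.\<close>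
    have "x (i + (b - a)) = x i" for i
    proof -
      obtain s where s: "s > max i (i + (b - a))" "\<And>i. i < 0 \<Longrightarrow> x (s + i) = x (a + i)" using copy by blast
      have "x (i + (b - a)) = x (a + (i + (b - a) - s))" using s(2)[of "i + (b - a) - s"] s(1) by simp
      also have "\<dots> = x (b + (i - s))" by (simp add: algebra_simps)
      also have "\<dots> = x (a + (i - s))" using b(2) s(1) by simp
      also have "\<dots> = x i" using s(2)[of "i - s"] s(1) by simp
      finally show ?thesis .
    qed
    then have "shift_power (int (nat (b - a))) x = x"
      using b(1) by (auto simp: shift_power_def)
    then show False using x(2) b(1) unfolding aperiodic_def by (metis zero_less_nat_eq diff_gt_0_iff_gt)
  qed
  have "0 \<in> ?S" using s0 by simp
  then have "?S \<noteq> {}" by (metis empty_iff)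
  with \<open>finite ?S\<close> have M: "Max ?S \<in> ?S" by (rule Max_in)
  have "shift_power k (shift_power (s0 + int (Max ?S)) x) \<notin> branching X" if "k > 0" for k
  proof
    assume "shift_power k (shift_power (s0 + int (Max ?S)) x) \<in> branching X"
    moreover have "k + (s0 + int (Max ?S)) = s0 + int (Max ?S + nat k)" using that by simp
    ultimately have "Max ?S + nat k \<in> ?S" by simp
    then have "Max ?S + nat k \<le> Max ?S" using \<open>finite ?S\<close> by (intro Max_ge)
    then show False using that by simp
  qed
  then show ?thesis using M by blast
qed

text \<open>Each orbit is represented by a point at its last branching time. Two such points with
  the same past and the same symbol at 0 coincide, since their first difference would be a later
  branching time.\<close>

lemma finite_orbits_asymptotic:
  "finite (shift_orbit ` {x \<in> X. aperiodic x \<and> asymptotic X x})"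
proof -
  let ?B = "{b \<in> branching X. \<forall>k>0. shift_power k b \<notin> branching X}"
  have "inj_on (\<lambda>b. (past b, b 0)) ?B"
  proof (rule inj_onI, rule ccontr)
    fix b c assume b: "b \<in> ?B" and c: "c \<in> ?B" and eq: "(past b, b 0) = (past c, c 0)" and ne: "b \<noteq> c"
    have "\<forall>i<1. b i = c i"
    proof (intro allI impI)
      fix i :: int assume "i < 1"
      then consider "i < 0" | "i = 0" by linarith
      then show "b i = c i" using eq by cases (auto simp: past_eq_iff)
    qed
    then obtain s where s: "s \<ge> 1" "b s \<noteq> c s" "\<forall>i<s. b i = c i"
      using first_difference[OF ne] by blast
    have "shift_power s b \<in> branching X"
      using b c s(2,3) by (intro branching_shiftI[of b c]) (auto simp: branching_def)
    then show False using b s(1) by simp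
  qed
  moreover have "finite ((\<lambda>b. (past b, b 0)) ` ?B)"
    by (rule finite_subset[of _ "past ` branching X \<times> UNIV"]) (use finite_branching_pasts in auto)
  ultimately have "finite ?B" by (rule finite_imageD[rotated])
  moreover have "shift_orbit ` {x \<in> X. aperiodic x \<and> asymptotic X x} \<subseteq> shift_orbit ` ?B"
  proof
    fix O1 assume "O1 \<in> shift_orbit ` {x \<in> X. aperiodic x \<and> asymptotic X x}"
    then obtain x where x: "O1 = shift_orbit x" "x \<in> X" "aperiodic x" "asymptotic X x" by blast
    then obtain y t where y: "y \<in> X" "x \<noteq> y" "\<forall>i<t. x i = y i" by (auto simp: asymptotic_def)
    obtain s where s: "x s \<noteq> y s" "\<forall>i<s. x i = y i" using first_difference[OF y(2,3)] by blast
    obtain r where r: "shift_power r x \<in> ?B"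
      using last_branching_time[OF x(2,3) branching_shiftI[OF x(2) y(1) s]] by auto
    show "O1 \<in> shift_orbit ` ?B" by (rule image_eqI[OF _ r]) (simp add: x(1))
  qed
  ultimately show ?thesis by (meson finite_imageI finite_subset)
qed

end

text \<open>If some finite stretch of the past always determines the next symbol, longer words have
  unique extensions and the complexity stops growing. Otherwise there are pairs with ever longer
  common pasts and different symbols at 0, and compactness yields a pair with a common infinite
  past.\<close>

lemma (in shift_space) branching_nonempty:
  assumes unbounded: "\<And>C. \<exists>n. complexity X n > C"
  shows "branching X \<noteq> {}"
proof (cases "\<exists>n. \<forall>x\<in>X. \<forall>y\<in>X. word (- int n) n x = word (- int n) n y \<longrightarrow> x 0 = y 0")
  case True
  then obtain n where n: "\<And>x y. x \<in> X \<Longrightarrow> y \<in> X \<Longrightarrow> word (- int n) n x = word (- int n) n y \<Longrightarrow> x 0 = y 0"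
    by blast
  have bound: "complexity X (n + j) \<le> complexity X n" for j
  proof (induction j)
    case (Suc j)
    let ?m = "n + j"
    let ?w = "word (- int ?m) ?m" and ?w' = "word (- int ?m) (Suc ?m)"
    have det: "?w' x = ?w' y" if "x \<in> X" "y \<in> X" "?w x = ?w y" for x y
    proof -
      have "word (- int n) n x = word (- int n) n y"
        using that(3) by (auto simp: word_eq_iff)
      then show ?thesis using n[OF that(1,2)] that(3) by (simp add: word_Suc)
    qed
    have "?w' ` X \<subseteq> (\<lambda>v. ?w' (inv_into X ?w v)) ` ?w ` X"
    proof
      fix v assume "v \<in> ?w' ` X"
      then obtain x where x: "x \<in> X" "v = ?w' x" by blast
      have "v = ?w' (inv_into X ?w (?w x))"
        unfolding x(2) by (rule det) (use x(1) in \<open>auto simp: f_inv_into_f inv_into_into\<close>)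
      then show "v \<in> (\<lambda>v. ?w' (inv_into X ?w v)) ` ?w ` X" using x(1) by blast
    qed
    then have "card (?w' ` X) \<le> card (?w ` X)" by (rule surj_card_le[rotated]) simp
    then have "complexity X (Suc ?m) \<le> complexity X ?m"
      by (simp add: complexity_eq[of _ "- int ?m"])
    then show ?case using Suc by simp
  qed simp
  \<comment> \<open>The sum stands in for the maximum over lengths up to \<open>n\<close>;
    \<open>bound\<close> covers the longer ones.\<close>
  obtain m where m: "complexity X m > (\<Sum>i\<le>n. complexity X i)" using unbounded by blast
  show ?thesis
  proof (cases "m \<le> n")
    case True
    then have "complexity X m \<le> (\<Sum>i\<le>n. complexity X i)" by (intro member_le_sum) auto
    then show ?thesis using m by simp
  next
    case False
    then have "complexity X m \<le> complexity X n" using bound[of "m - n"] by simp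
    also have "\<dots> \<le> (\<Sum>i\<le>n. complexity X i)" by (intro member_le_sum) auto
    finally show ?thesis using m by simp
  qed
next
  case False
  then obtain u v where uv: "\<And>n. u n \<in> X" "\<And>n. v n \<in> X"
    "\<And>n. word (- int n) n (u n) = word (- int n) n (v n)" "\<And>n. u n 0 \<noteq> v n 0"
    by metis
  \<comment> \<open>Pairing the sequences over the product alphabet makes both converge along the
    same indices.\<close>
  obtain p where p: "\<And>n. \<exists>m\<ge>n. agree n (\<lambda>i. (u m i, v m i)) p"
    by (rule cluster_point[of "\<lambda>m i. (u m i, v m i)"]) blast
  define x where "x = fst \<circ> p"
  define y where "y = snd \<circ> p"
  have xy: "\<exists>m\<ge>n. agree n x (u m) \<and> agree n y (v m)" for n
    using p[of n] unfolding agree_def x_def y_def by (metis comp_apply fst_conv snd_conv)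
  have "x \<in> X" "y \<in> X"
    by (rule closedin_agree_limit[OF closed], use xy uv in blast)+
  moreover have "x 0 \<noteq> y 0"
    using xy[of 0] uv(4) unfolding agree_def by (metis abs_zero of_nat_0_le_iff)
  moreover have "past x = past y"
    unfolding past_eq_iff
  proof (intro allI impI)
    fix i :: int assume "i < 0"
    obtain m where m: "m \<ge> nat \<bar>i\<bar>" "agree (nat \<bar>i\<bar>) x (u m)" "agree (nat \<bar>i\<bar>) y (v m)" using xy by blast
    then have "x i = u m i" "y i = v m i" by (auto simp: agree_def)
    moreover have "u m i = v m i" using uv(3)[of m] m(1) \<open>i < 0\<close> by (auto simp: word_eq_iff)
    ultimately show "x i = y i" by simp
  qed
  ultimately show ?thesis unfolding branching_def by blast
qed

text \<open>A point of period \<open>d\<close> has at most \<open>d\<close> points in its orbit, and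
  by density these show all words of \<open>X\<close>, so the complexity would be at most
  \<open>d\<close>.\<close>

lemma (in shift_space) dense_orbit_aperiodic:
  assumes unbounded: "\<And>C. \<exists>n. complexity X n > C" and x: "dense_orbit X x"
  shows "aperiodic x"
  unfolding aperiodic_def
proof (intro allI impI notI)
  fix d :: nat assume d: "0 < d" "shift_power (int d) x = x"
  have iter: "shift_power (int d * k) x = x" for k
  proof (induction k rule: int_induct[where k = 0])
    case (step1 i)
    have "shift_power (int d * (i + 1)) x = shift_power (int d * i) (shift_power (int d) x)"
      by (simp add: algebra_simps)
    then show ?case using step1 d by simp
  next
    case (step2 i)
    have "shift_power (int d * (i - 1)) x = shift_power (int d * (i - 1)) (shift_power (int d) x)"
      using d by simp
    then show ?case using step2 by (simp add: algebra_simps)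
  qed simp
  have mod: "shift_power k x = shift_power (k mod int d) x" for k
  proof -
    have "shift_power k x = shift_power (k mod int d) (shift_power (int d * (k div int d)) x)"
      by simp
    then show ?thesis by (simp only: iter)
  qed
  have "complexity X n \<le> d" for n
  proof -
    have "word 0 n ` X \<subseteq> (\<lambda>k. word 0 n (shift_power k x)) ` {0..<int d}"
    proof
      fix v assume "v \<in> word 0 n ` X"
      then obtain z where z: "z \<in> X" "v = word 0 n z" by blast
      then obtain k where "agree n z (shift_power k x)" using x unfolding dense_orbit_def by blast
      then have "agree n z (shift_power (k mod int d) x)" using mod by metis
      then have "v = word 0 n (shift_power (k mod int d) x)"
        unfolding z(2) word_eq_iff by (auto simp: agree_def)
      then show "v \<in> (\<lambda>k. word 0 n (shift_power k x)) ` {0..<int d}" using d by auto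
    qed
    then have "card (word 0 n ` X) \<le> card {0..<int d}" by (rule surj_card_le[rotated]) simp
    then show ?thesis by (simp add: complexity_eq[of n 0])
  qed
  then show False using unbounded[of d] by (meson leD)
qed

section \<open>Continuous maps commuting with the shift\<close>

definition endomorphism :: "(int \<Rightarrow> 'a) set \<Rightarrow> ((int \<Rightarrow> 'a) \<Rightarrow> int \<Rightarrow> 'a) \<Rightarrow> bool" where
  "endomorphism X f \<longleftrightarrow> (\<forall>x\<in>X. f x \<in> X) \<and> (\<forall>x\<in>X. \<forall>k. f (shift_power k x) = shift_power k (f x)) \<and>
     (\<forall>x\<in>X. \<forall>n. \<exists>m. \<forall>y\<in>X. agree m x y \<longrightarrow> agree n (f x) (f y))"

lemma endomorphismD:
  assumes "endomorphism X f" "x \<in> X"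
  shows "f x \<in> X" "f (shift_power k x) = shift_power k (f x)"
  using assms unfolding endomorphism_def by blast+

lemma endomorphism_continuous:
  assumes "endomorphism X f" "x \<in> X"
  obtains m where "\<And>y. y \<in> X \<Longrightarrow> agree m x y \<Longrightarrow> agree n (f x) (f y)"
  using assms unfolding endomorphism_def by blast

context shift_space
begin

lemma endomorphismI:
  assumes cont: "continuous_map (subtopology seq_topology X) (subtopology seq_topology X) f"
    and comm: "\<And>x. x \<in> X \<Longrightarrow> f (left_shift x) = left_shift (f x)"
  shows "endomorphism X f"
proof -
  have fX: "f x \<in> X" if "x \<in> X" for x
    using cont that by (auto simp: continuous_map_def)
  have "f (shift_power k x) = shift_power k (f x)" if x: "x \<in> X" for x k
  proof (induction k rule: int_induct[where k = 0])
    case (step1 i)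
    have "f (left_shift (shift_power i x)) = left_shift (f (shift_power i x))"
      using x by (intro comm) simp
    then show ?case using step1 by (simp add: shift_power_1[symmetric] add.commute)
  next
    case (step2 i)
    have "f (left_shift (shift_power (i - 1) x)) = left_shift (f (shift_power (i - 1) x))"
      using x by (intro comm) simp
    then have "shift_power i (f x) = shift_power 1 (f (shift_power (i - 1) x))"
      using step2 by (simp add: shift_power_1[symmetric])
    then have "shift_power (- 1) (shift_power i (f x)) = f (shift_power (i - 1) x)" by simp
    then show ?case by simp
  qed simp
  moreover have "\<exists>m. \<forall>y\<in>X. agree m x y \<longrightarrow> agree n (f x) (f y)" if x: "x \<in> X" for x n
  proof -
    have "continuous_map (subtopology seq_topology X) seq_topology f"
      using cont by (simp add: continuous_map_in_subtopology)
    then have "openin (subtopology seq_topology X)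
        {y \<in> topspace (subtopology seq_topology X). f y \<in> {z. agree n (f x) z}}"
      using openin_agree by (rule openin_continuous_map_preimage)
    then have "openin (subtopology seq_topology X) {y \<in> X. agree n (f x) (f y)}" by simp
    then obtain U where U: "openin seq_topology U" "{y \<in> X. agree n (f x) (f y)} = U \<inter> X"
      unfolding openin_subtopology by (elim exE conjE) (rule that)
    have "x \<in> {y \<in> X. agree n (f x) (f y)}" using x by simp
    then have xU: "x \<in> U" unfolding U(2) by (rule IntD1)
    obtain m where m: "\<And>y. agree m x y \<Longrightarrow> y \<in> U"
      by (rule openin_seq_topology_agree[OF U(1) xU]) blast
    have "agree n (f x) (f y)" if "y \<in> X" "agree m x y" for y
    proof -
      have "y \<in> U \<inter> X" using m that by (intro IntI)
      then show ?thesis unfolding U(2)[symmetric] by simp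
    qed
    then show ?thesis by (intro exI[of _ m]) simp
  qed
  ultimately show ?thesis unfolding endomorphism_def by (intro conjI ballI allI fX)
qed

text \<open>The inverse delivered by the homeomorphism need not be extensional, so it is recorded as
  an endomorphism rather than as a group element.\<close>

lemma automorphism_endomorphism:
  assumes f: "f \<in> shift_automorphisms X"
  obtains g where "endomorphism X f" "endomorphism X g"
    "\<And>x. x \<in> X \<Longrightarrow> g (f x) = x" "\<And>x. x \<in> X \<Longrightarrow> f (g x) = x"
proof -
  obtain g where g: "homeomorphic_maps (subtopology seq_topology X) (subtopology seq_topology X) f g"
    using f by (auto simp: shift_automorphisms_def homeomorphic_map_maps)
  have comm: "f (left_shift x) = left_shift (f x)" if "x \<in> X" for x
    using f that by (simp add: shift_automorphisms_def)
  have gX: "g x \<in> X" and gf: "g (f x) = x" "f (g x) = x" if "x \<in> X" for x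
    using g that by (auto simp: homeomorphic_maps_def continuous_map_def)
  have sX: "left_shift x \<in> X" if "x \<in> X" for x
    using that shift_power_in_iff[of 1 x] by (simp add: shift_power_1)
  have "g (left_shift x) = left_shift (g x)" if "x \<in> X" for x
    using comm[OF gX[OF that]] gf sX gX that by metis
  then have "endomorphism X g" using g by (intro endomorphismI) (auto simp: homeomorphic_maps_def)
  moreover have "endomorphism X f" using g comm by (intro endomorphismI) (auto simp: homeomorphic_maps_def)
  ultimately show thesis using gf by (intro that)
qed

text \<open>Continuity at \<open>x\<close> turns a close return of \<open>x\<close> into a close
  return of \<open>f x\<close> after the same time. Applied to inverses, this shows that
  automorphisms preserve non-recurrence.\<close>

lemma endomorphism_recurrent:
  assumes f: "endomorphism X f" and x: "x \<in> X" "recurrent e x"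
  shows "recurrent e (f x)"
  unfolding recurrent_def
proof
  fix n
  obtain m where m: "\<And>y. y \<in> X \<Longrightarrow> agree m x y \<Longrightarrow> agree n (f x) (f y)"
    by (rule endomorphism_continuous[OF f x(1)]) blast
  obtain k :: nat where k: "0 < k" "agree m (shift_power (e * int k) x) x"
    using x(2) unfolding recurrent_def by blast
  then have "agree n (f x) (f (shift_power (e * int k) x))"
    using x(1) by (intro m) (auto intro: agree_sym)
  then show "\<exists>k::nat. 0 < k \<and> agree n (shift_power (e * int k) (f x)) (f x)"
    using k(1) endomorphismD(2)[OF f x(1)] by (metis agree_sym)
qed

text \<open>This is the Curtis-Hedlund-Lyndon theorem. Counterexamples for all window sizes would
  accumulate at one point and contradict continuity there.\<close>

lemma endomorphism_block_code:
  assumes f: "endomorphism X f"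
  shows "\<exists>N. \<forall>x\<in>X. \<forall>y\<in>X. agree N x y \<longrightarrow> f x 0 = f y 0"
proof (rule ccontr)
  assume "\<not> ?thesis"
  then obtain u v where uv: "\<And>N. u N \<in> X" "\<And>N. v N \<in> X" "\<And>N. agree N (u N) (v N)" "\<And>N. f (u N) 0 \<noteq> f (v N) 0"
    by metis
  obtain x where x: "x \<in> X" "\<And>n. \<exists>m\<ge>n. agree n (u m) x"
    by (rule cluster_point_in[OF closed, of u]) (use uv(1) in blast)+
  obtain n where n: "\<And>y. y \<in> X \<Longrightarrow> agree n x y \<Longrightarrow> agree 0 (f x) (f y)"
    by (rule endomorphism_continuous[OF f x(1)]) blast
  obtain m where m: "m \<ge> n" "agree n (u m) x" using x(2) by blast
  have "agree n x (u m)" using m(2) by (rule agree_sym)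
  moreover have "agree n x (v m)" using m agree_mono[OF uv(3)] agree_sym agree_trans by blast
  ultimately have "agree 0 (f x) (f (u m))" "agree 0 (f x) (f (v m))" using n uv by blast+
  then have "f (u m) 0 = f (v m) 0" by (simp add: agree_def)
  then show False using uv(4) by blast
qed

text \<open>A block code of radius \<open>N\<close> keeps the common past up to a loss of
  \<open>N\<close> positions, and injectivity keeps the two images apart.\<close>

lemma endomorphism_asymptotic:
  assumes f: "endomorphism X f" and inj: "inj_on f X" and x: "x \<in> X" "asymptotic X x"
  shows "asymptotic X (f x)"
proof -
  obtain N where N: "\<And>x y. x \<in> X \<Longrightarrow> y \<in> X \<Longrightarrow> agree N x y \<Longrightarrow> f x 0 = f y 0"
    using endomorphism_block_code[OF f] by blast
  obtain y t where y: "y \<in> X" "y \<noteq> x" "\<And>i. i < t \<Longrightarrow> x i = y i" using x(2) by (auto simp: asymptotic_def)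
  have "f x i = f y i" if "i < t - int N" for i
  proof -
    have "agree N (shift_power i x) (shift_power i y)"
      unfolding agree_def shift_power_def using that y(3) by auto
    then have "f (shift_power i x) 0 = f (shift_power i y) 0" using x(1) y(1) by (intro N) auto
    then have "shift_power i (f x) 0 = shift_power i (f y) 0"
      using endomorphismD(2)[OF f] x(1) y(1) by simp
    then show ?thesis by (simp add: shift_power_def)
  qed
  moreover have "f y \<noteq> f x" using inj x(1) y(1,2) by (meson inj_onD)
  moreover have "f y \<in> X" using endomorphismD(1)[OF f y(1)] .
  ultimately show ?thesis unfolding asymptotic_def by blast
qed

text \<open>The equation at \<open>s\<close> spreads along its orbit by commutation with the shift
  and to all of \<open>X\<close> by continuity.\<close>

lemma endomorphism_eq_on_dense:
  assumes a: "endomorphism X a" and b: "endomorphism X b" and s: "s \<in> X" "dense_orbit X s"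
    and eq: "a s = shift_power k (b s)" and x: "x \<in> X"
  shows "a x = shift_power k (b x)"
proof (rule agree_all_imp_eq)
  fix n
  obtain m1 where m1: "\<And>y. y \<in> X \<Longrightarrow> agree m1 x y \<Longrightarrow> agree n (a x) (a y)"
    by (rule endomorphism_continuous[OF a x]) blast
  obtain m2 where m2: "\<And>y. y \<in> X \<Longrightarrow> agree m2 x y \<Longrightarrow> agree (n + nat \<bar>k\<bar>) (b x) (b y)"
    by (rule endomorphism_continuous[OF b x]) blast
  obtain l where l: "agree (max m1 m2) x (shift_power l s)" using s(2) x unfolding dense_orbit_def by blast
  have "agree n (a x) (a (shift_power l s))"
    using s(1) agree_mono[OF l] by (intro m1) auto
  moreover have "agree (n + nat \<bar>k\<bar>) (b x) (b (shift_power l s))"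
    using s(1) agree_mono[OF l] by (intro m2) auto
  then have "agree n (shift_power k (b x)) (shift_power k (b (shift_power l s)))"
    by (rule agree_shift) simp
  moreover have "a (shift_power l s) = shift_power k (b (shift_power l s))"
    using eq endomorphismD(2)[OF a s(1)] endomorphismD(2)[OF b s(1)] by (simp add: add.commute)
  ultimately show "agree n (a x) (shift_power k (b x))" by (metis agree_sym agree_trans)
qed

section \<open>The subgroup generated by the shift and its cosets\<close>

lemma carrier_Aut_shift: "carrier (Aut_shift X) = shift_automorphisms X"
  by (simp add: Aut_shift_def)

lemma mult_Aut_shift:
  assumes "f \<in> shift_automorphisms X" "g \<in> shift_automorphisms X" "x \<in> X"
  shows "(f \<otimes>\<^bsub>Aut_shift X\<^esub> g) x = f (g x)"
  using assms subsetD[OF shift_automorphisms_subset_Bij, of _ X]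
  by (simp add: Aut_shift_def BijGroup_def compose_def)

lemma left_shift_pow:
  assumes "x \<in> X"
  shows "(restrict left_shift X [^]\<^bsub>Aut_shift X\<^esub> (k::int)) x = shift_power k x"
proof -
  interpret G: group "Aut_shift X" by (rule group_Aut_shift[OF shift])
  let ?s = "restrict left_shift X"
  have s: "?s \<in> carrier (Aut_shift X)" by (rule left_shift_in_Aut_shift[OF shift])
  have Suc: "(?s [^]\<^bsub>Aut_shift X\<^esub> (i + 1)) y = (?s [^]\<^bsub>Aut_shift X\<^esub> i) (shift_power 1 y)" if "y \<in> X" for i :: int and y
  proof -
    have "?s [^]\<^bsub>Aut_shift X\<^esub> (i + 1) = ?s [^]\<^bsub>Aut_shift X\<^esub> i \<otimes>\<^bsub>Aut_shift X\<^esub> ?s"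
      using s by (simp add: G.int_pow_mult)
    then show ?thesis
      using mult_Aut_shift[of "?s [^]\<^bsub>Aut_shift X\<^esub> i" ?s y] s that G.int_pow_closed[OF s, of i]
      by (simp add: carrier_Aut_shift shift_power_1)
  qed
  \<comment> \<open>The point is generalized because \<open>Suc\<close> moves one shift into the
    argument.\<close>
  show ?thesis
    using assms
  proof (induction k arbitrary: x rule: int_induct[where k = 0])
    case base
    then show ?case by (simp add: Aut_shift_def BijGroup_def)
  next
    case (step1 i)
    then show ?case using Suc[of x i] by (simp add: add.commute del: restrict_apply)
  next
    case (step2 i)
    have "(?s [^]\<^bsub>Aut_shift X\<^esub> (i - 1)) (shift_power 1 (shift_power (- 1) x)) = shift_power i (shift_power (- 1) x)"
      using Suc[of "shift_power (- 1) x" "i - 1"] step2 by (simp del: restrict_apply)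
    then show ?case by (simp del: restrict_apply)
  qed
qed

lemma shift_subgroup_eq:
  "shift_subgroup X = range (\<lambda>k::int. restrict left_shift X [^]\<^bsub>Aut_shift X\<^esub> k)"
proof -
  interpret G: group "Aut_shift X" by (rule group_Aut_shift[OF shift])
  show ?thesis
    unfolding shift_subgroup_def by (auto simp: G.generate_pow[OF left_shift_in_Aut_shift[OF shift]])
qed

text \<open>An aperiodic point separates the powers of the shift, so exponents are determined by
  them.\<close>

lemma shift_subgroup_iso_integer_group:
  assumes "x \<in> X" "aperiodic x"
  shows "Aut_shift X\<lparr>carrier := shift_subgroup X\<rparr> \<cong> integer_group"
proof -
  interpret G: group "Aut_shift X" by (rule group_Aut_shift[OF shift])
  let ?s = "restrict left_shift X"
  let ?h = "\<lambda>k::int. ?s [^]\<^bsub>Aut_shift X\<^esub> k"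
  have s: "?s \<in> carrier (Aut_shift X)" by (rule left_shift_in_Aut_shift[OF shift])
  have inj: "inj ?h"
  proof (rule linorder_inj_onI)
    fix k l :: int assume "k < l"
    show "?h k \<noteq> ?h l"
    proof
      assume "?h k = ?h l"
      then have "shift_power (- k) (shift_power k x) = shift_power (- k) (shift_power l x)"
        using left_shift_pow[OF assms(1)] by metis
      then have "shift_power (int (nat (l - k))) x = x" using \<open>k < l\<close> by simp
      moreover have "0 < nat (l - k)" using \<open>k < l\<close> by simp
      ultimately show False using assms(2) unfolding aperiodic_def by blast
    qed
  qed auto
  have "?h \<in> hom integer_group (Aut_shift X\<lparr>carrier := shift_subgroup X\<rparr>)"
    by (rule homI) (auto simp: shift_subgroup_eq G.int_pow_mult[OF s])
  moreover have "bij_betw ?h (carrier integer_group) (carrier (Aut_shift X\<lparr>carrier := shift_subgroup X\<rparr>))"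
    using inj by (simp add: bij_betw_def shift_subgroup_eq)
  ultimately have "?h \<in> iso integer_group (Aut_shift X\<lparr>carrier := shift_subgroup X\<rparr>)"
    by (simp add: iso_def)
  then show ?thesis
    using group.iso_sym[OF group_integer_group] by (auto simp: is_iso_def)
qed

lemma finite_rcosets_shift_subgroup:
  assumes S: "S \<subseteq> X" "s \<in> S" "dense_orbit X s" "finite (shift_orbit ` S)"
    and inv: "\<And>f. f \<in> shift_automorphisms X \<Longrightarrow> f s \<in> S"
  shows "finite (rcosets\<^bsub>Aut_shift X\<^esub> shift_subgroup X)"
proof -
  interpret G: group "Aut_shift X" by (rule group_Aut_shift[OF shift])
  let ?A = "carrier (Aut_shift X)"
  let ?c = "\<lambda>f. shift_subgroup X #>\<^bsub>Aut_shift X\<^esub> f"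
  have sX: "s \<in> X" using S by blast
  have sub: "subgroup (shift_subgroup X) (Aut_shift X)"
    using shift_subgroup_normal[OF shift] by (simp add: normal_def)
  \<comment> \<open>Images of \<open>s\<close> on a common orbit differ by a power of the shift; by
    density of the orbit of \<open>s\<close> the same power relates the two maps everywhere.\<close>
  have same: "?c a = ?c b" if ab: "a \<in> ?A" "b \<in> ?A" "shift_orbit (a s) = shift_orbit (b s)" for a b
  proof -
    have aut: "a \<in> shift_automorphisms X" "b \<in> shift_automorphisms X" using ab by (auto simp: carrier_Aut_shift)
    have "a s \<in> shift_orbit (a s)"
      unfolding shift_orbit_def by (metis (mono_tags) mem_Collect_eq shift_power_zero)
    then obtain k where k: "a s = shift_power k (b s)"
      unfolding ab(3) by (auto simp: shift_orbit_def)
    let ?t = "restrict left_shift X [^]\<^bsub>Aut_shift X\<^esub> k"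
    have t: "?t \<in> shift_subgroup X" by (simp add: shift_subgroup_eq)
    then have tA: "?t \<in> ?A" using subgroup.mem_carrier[OF sub] by blast
    have ea: "endomorphism X a" and eb: "endomorphism X b"
      using automorphism_endomorphism aut by metis+
    have "a = ?t \<otimes>\<^bsub>Aut_shift X\<^esub> b"
    proof (rule extensionalityI[where A = X])
      show "a \<in> extensional X" using aut by (simp add: shift_automorphisms_def)
      have "?t \<otimes>\<^bsub>Aut_shift X\<^esub> b \<in> ?A" using tA ab(2) by simp
      then show "?t \<otimes>\<^bsub>Aut_shift X\<^esub> b \<in> extensional X"
        by (simp add: carrier_Aut_shift shift_automorphisms_def)
      fix x assume x: "x \<in> X"
      have "(?t \<otimes>\<^bsub>Aut_shift X\<^esub> b) x = ?t (b x)"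
        using tA aut(2) x by (intro mult_Aut_shift) (simp_all add: carrier_Aut_shift)
      also have "\<dots> = shift_power k (b x)"
        using endomorphismD(1)[OF eb x] by (rule left_shift_pow)
      finally show "a x = (?t \<otimes>\<^bsub>Aut_shift X\<^esub> b) x"
        using endomorphism_eq_on_dense[OF ea eb sX S(3) k x] by simp
    qed
    then have "a \<in> ?c b" using t by (auto simp: r_coset_def)
    then show ?thesis using G.repr_independence[OF _ ab(2) sub] by simp
  qed
  have "finite ((\<lambda>f. shift_orbit (f s)) ` ?A)"
    by (rule finite_subset[OF _ S(4)]) (use inv in \<open>auto simp: carrier_Aut_shift\<close>)
  \<comment> \<open>By \<open>same\<close> the coset is a function of the orbit of the image of
    \<open>s\<close>.\<close>
  moreover have "?c ` ?A \<subseteq> (\<lambda>v. ?c (inv_into ?A (\<lambda>f. shift_orbit (f s)) v)) ` (\<lambda>f. shift_orbit (f s)) ` ?A"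
  proof
    fix C assume "C \<in> ?c ` ?A"
    then obtain a where a: "a \<in> ?A" "C = ?c a" by blast
    let ?o = "\<lambda>f. shift_orbit (f s)"
    have im: "?o a \<in> ?o ` ?A" using a(1) by blast
    have "C = ?c (inv_into ?A ?o (?o a))"
      unfolding a(2)
      by (rule same[OF a(1) inv_into_into[OF im]]) (simp only: f_inv_into_f[OF im])
    then show "C \<in> (\<lambda>v. ?c (inv_into ?A ?o v)) ` ?o ` ?A" using im by blast
  qed
  ultimately have "finite (?c ` ?A)" by (meson finite_imageI finite_subset)
  moreover have "rcosets\<^bsub>Aut_shift X\<^esub> shift_subgroup X = ?c ` ?A"
    by (auto simp: RCOSETS_def)
  ultimately show ?thesis by simp
qed

end

section \<open>The two cases, the growth hypotheses and the conclusion\<close>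

lemma (in linear_shift) finite_rcosets:
  assumes unbounded: "\<And>C. \<exists>n. complexity X n > C" and x: "x \<in> X" "dense_orbit X x"
  shows "finite (rcosets\<^bsub>Aut_shift X\<^esub> shift_subgroup X)"
proof (cases "\<forall>z\<in>X. dense_orbit X z")
  \<comment> \<open>In this case every point is aperiodic, and a branching point, being asymptotic
    to its partner, serves as \<open>s\<close>.\<close>
  case True
  obtain s where "s \<in> branching X" using branching_nonempty[OF unbounded] by blast
  then obtain y where s: "s \<in> X" "y \<in> X" "past s = past y" "s 0 \<noteq> y 0" by (auto simp: branching_def)
  then have as: "asymptotic X s"
    unfolding asymptotic_def past_eq_iff by (intro bexI[of _ y] conjI exI[of _ 0]) auto
  show ?thesis
  proof (rule finite_rcosets_shift_subgroup)
    show "{x \<in> X. aperiodic x \<and> asymptotic X x} \<subseteq> X" by blast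
    show "dense_orbit X s" using True s(1) by blast
    then show "s \<in> {x \<in> X. aperiodic x \<and> asymptotic X x}"
      using s(1) as dense_orbit_aperiodic[OF unbounded] by blast
    show "finite (shift_orbit ` {x \<in> X. aperiodic x \<and> asymptotic X x})"
      by (rule finite_orbits_asymptotic)
    fix f assume "f \<in> shift_automorphisms X"
    then obtain g where fg: "endomorphism X f" "endomorphism X g" "\<And>x. x \<in> X \<Longrightarrow> g (f x) = x"
      by (rule automorphism_endomorphism) (rule that)
    have fs: "f s \<in> X" using endomorphismD(1)[OF fg(1) s(1)] .
    have "inj_on f X" by (rule inj_on_inverseI) (rule fg(3))
    then show "f s \<in> {x \<in> X. aperiodic x \<and> asymptotic X x}"
      using endomorphism_asymptotic[OF fg(1) _ s(1) as] fs True dense_orbit_aperiodic[OF unbounded] by blast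
  qed
next
  case False
  then obtain z where z: "z \<in> X" "\<not> dense_orbit X z" by blast
  obtain e s where s: "e \<in> {1, - 1}" "s \<in> X" "dense_orbit X s" "\<not> recurrent e s"
    by (rule dense_not_recurrent_exists[OF x z])
  show ?thesis
  proof (rule finite_rcosets_shift_subgroup)
    show "{x \<in> X. \<not> recurrent e x} \<subseteq> X" by blast
    show "s \<in> {x \<in> X. \<not> recurrent e x}" "dense_orbit X s" using s by blast+
    show "finite (shift_orbit ` {x \<in> X. \<not> recurrent e x})"
      using s(1) by (rule finite_orbits_not_recurrent)
    fix f assume "f \<in> shift_automorphisms X"
    then obtain g where fg: "endomorphism X f" "endomorphism X g" "\<And>x. x \<in> X \<Longrightarrow> g (f x) = x"
      by (rule automorphism_endomorphism) (rule that)
    have fs: "f s \<in> X" using endomorphismD(1)[OF fg(1) s(2)] .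
    \<comment> \<open>The inverse \<open>g\<close> would carry recurrence of \<open>f s\<close> back
      to \<open>s\<close>.\<close>
    have "\<not> recurrent e (f s)"
      using endomorphism_recurrent[OF fg(2) fs] fg(3)[OF s(2)] s(4) by force
    then show "f s \<in> {x \<in> X. \<not> recurrent e x}" using fs by blast
  qed
qed

lemma limsup_finite_imp_linear:
  assumes "limsup (\<lambda>n. ereal (real (p n) / real n)) < \<infinity>"
  obtains K where "\<forall>\<^sub>F n in sequentially. p n \<le> K * n"
proof -
  obtain c where "limsup (\<lambda>n. ereal (real (p n) / real n)) < ereal c"
    using ereal_dense2[OF assms] by auto
  then have "\<forall>\<^sub>F n in sequentially. ereal (real (p n) / real n) < ereal c" by (rule Limsup_lessD)
  \<comment> \<open>Index 0 is excluded: division by zero gives 0 there and says nothing about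
    \<open>p 0\<close>.\<close>
  then have "\<forall>\<^sub>F n in sequentially. p n \<le> nat \<lceil>c\<rceil> * n"
    using eventually_gt_at_top[of 0]
  proof eventually_elim
    case (elim n)
    then have "real (p n) \<le> c * real n" by (simp add: field_simps)
    also have "\<dots> \<le> real (nat \<lceil>c\<rceil>) * real n" by (intro mult_right_mono) linarith+
    finally show ?case by (metis of_nat_le_iff of_nat_mult)
  qed
  then show thesis by (rule that)
qed

text \<open>For bounded \<open>p\<close> the quotient tends to 0, so a positive limsup rules out
  bounded complexity.\<close>

lemma limsup_positive_imp_unbounded:
  assumes "0 < limsup (\<lambda>n. ereal (real (p n) / real n))"
  shows "\<exists>n. p n > C"
proof (rule ccontr)
  assume "\<not> ?thesis"
  then have le: "p n \<le> C" for n by (simp add: not_less)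
  have "(\<lambda>n. real (p n) / real n) \<longlonglongrightarrow> 0"
  proof (rule tendsto_sandwich[of "\<lambda>_. 0" _ _ "\<lambda>n. real C / real n"])
    show "\<forall>\<^sub>F n in sequentially. real (p n) / real n \<le> real C / real n"
      using le by (intro always_eventually allI divide_right_mono) auto
    show "(\<lambda>n. real C / real n) \<longlonglongrightarrow> 0" by (rule lim_const_over_n)
  qed auto
  then have "(\<lambda>n. ereal (real (p n) / real n)) \<longlonglongrightarrow> ereal 0" by simp
  then have "limsup (\<lambda>n. ereal (real (p n) / real n)) = ereal 0"
    by (intro lim_imp_Limsup) auto
  then show False using assms by simp
qed

theorem theorem1p3:
  fixes X :: "(int \<Rightarrow> 'a::finite) set"
  assumes "transitive_shift X"
    and "0 < limsup (\<lambda>n. ereal (real (complexity X n) / real n))"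
    and "limsup (\<lambda>n. ereal (real (complexity X n) / real n)) < \<infinity>"
  shows "finite (carrier (Aut_shift X Mod shift_subgroup X)) \<and>
         virtually (Aut_shift X) integer_group"
proof -
  have shift: "is_shift X" using assms(1) by (simp add: transitive_shift_def)
  obtain K where K: "\<forall>\<^sub>F n in sequentially. complexity X n \<le> K * n"
    using limsup_finite_imp_linear[OF assms(3)] by blast
  interpret linear_shift X K
    using shift K by unfold_locales
  have unbounded: "\<exists>n. complexity X n > C" for C
    using assms(2) by (rule limsup_positive_imp_unbounded)
  obtain x where x: "x \<in> X" "dense_orbit X x"
    using assms(1) dense_orbit_iff by (auto simp: transitive_shift_def)
  have fin: "finite (rcosets\<^bsub>Aut_shift X\<^esub> shift_subgroup X)"
    using unbounded x by (rule finite_rcosets)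
  moreover have "subgroup (shift_subgroup X) (Aut_shift X)"
    using shift_subgroup_normal[OF shift] by (simp add: normal_def)
  moreover have "Aut_shift X\<lparr>carrier := shift_subgroup X\<rparr> \<cong> integer_group"
    using x(1) dense_orbit_aperiodic[OF unbounded x(2)] by (rule shift_subgroup_iso_integer_group)
  \<comment> \<open>The carrier of the quotient is the set of right cosets, and the shift subgroup
    itself witnesses that the group is virtually \<open>integer_group\<close>.\<close>
  ultimately show ?thesis
    by (auto simp: FactGroup_def virtually_def)
qed

end
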